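(* Let $\Gamma$ be a tree on the vertex set $[m+1]$, $m\ge 1$, and let $I(\Gamma)$ be the generic monomial ideal attached to $\Gamma$, with minimal monomial generators $v_1,\dots,v_{m+1}$ (in this labelling). Then $\mathcal{T}(I(\Gamma))=\{\Gamma\}$.
   Context: $[m+1]=\{1,\dots,m+1\}$. Let $K$ be a field, and for each edge $\{i,j\}$ of $\Gamma$ let $x_{ij}$ and $x_{ji}$ be two distinct indeterminates; all these indeterminates (two per edge) are distinct and $S$ denotes the polynomial ring over $K$ in them. Fix an arbitrary ordering of the $m$ edges of $\Gamma$. The $m\times(m+1)$ matrix $A(\Gamma)=(a_{kl})$ is defined as follows: if the $k$th edge is $\{i,j\}$ with $i<j$, then $a_{ki}=-x_{ij}$, $a_{kj}=x_{ji}$, and $a_{kl}=0$ for $l\ne i,j$. For distinct vertices $r,i$ let $b(r,i)$ be the vertex following $r$ on the unique path in $\Gamma$ from $r$ to $i$. $I(\Gamma)$ is the ideal generated by the maximal minors of $A(\Gamma)$. Up to sign, the minor obtained by omitting the $i$th column is the monomial $v_i=\prod_{1\le r\le m+1,\ r\ne i}x_{r\,b(r,i)}$. The ideal $I(\Gamma)$ is Cohen-Macaulay (i.e. $S/I(\Gamma)$ is Cohen-Macaulay) of codimension (height) $2$. For a Cohen-Macaulay monomial ideal $I\subset S$ of codimension $2$ with minimal monomial generators $u_1,\dots,u_{m+1}$, let $U$ be the kernel of the map $\bigoplus_{i=1}^{m+1} Se_i\to S$, $e_i\mapsto u_i$; $U$ is a free $S$-module of rank $m$. For $i<j$ the Taylor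 relation is $r_{ij}=u_{ji}e_j-u_{ij}e_i\in U$, where $u_{ji}=u_i/\gcd(u_i,u_j)$ and $u_{ij}=u_j/\gcd(u_i,u_j)$. A Hilbert-Burch matrix of $I$ is an $m\times(m+1)$ matrix whose rows are $m$ Taylor relations forming a minimal system of generators (equivalently a basis) of $U$. To such a matrix one assigns the graph on $[m+1]$ whose edges are the pairs $\{i,j\}$ for which $r_{ij}$ is a row of the matrix; this graph is a tree, called a relation tree of $I$. $\mathcal{T}(I)$ denotes the set of all relation trees of $I$. *)

theory Defs
  imports
    "HOL-Library.Poly_Mapping"
    "HOL-Algebra.Ideal"
    "Jordan_Normal_Form.DL_Submatrix"
    "Jordan_Normal_Form.VS_Connect"
begin

text \<open>
  A finite simple graph is given by its vertex set and its set of edges, an edge being a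
  two-element set of vertices; a path is the list of its (pairwise distinct) vertices.
\<close>

definition simple_graph :: "'a set \<Rightarrow> 'a set set \<Rightarrow> bool" where
  "simple_graph V E \<longleftrightarrow> finite V \<and> (\<forall>e\<in>E. \<exists>i\<in>V. \<exists>j\<in>V. i \<noteq> j \<and> e = {i, j})"

definition vertex_path :: "'a set set \<Rightarrow> 'a list \<Rightarrow> bool" where
  "vertex_path E p \<longleftrightarrow>
     p \<noteq> [] \<and> distinct p \<and> (\<forall>k. Suc k < length p \<longrightarrow> {p ! k, p ! Suc k} \<in> E)"

definition path_from_to :: "'a set set \<Rightarrow> 'a \<Rightarrow> 'a \<Rightarrow> 'a list \<Rightarrow> bool" where
  "path_from_to E r i p \<longleftrightarrow> vertex_path E p \<and> hd p = r \<and> last p = i"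

definition graph_cycle :: "'a set set \<Rightarrow> 'a list \<Rightarrow> bool" where
  "graph_cycle E p \<longleftrightarrow> vertex_path E p \<and> length p \<ge> 3 \<and> {last p, hd p} \<in> E"

definition tree_graph :: "'a set \<Rightarrow> 'a set set \<Rightarrow> bool" where
  "tree_graph V E \<longleftrightarrow> simple_graph V E \<and> V \<noteq> {} \<and>
     (\<forall>r\<in>V. \<forall>i\<in>V. \<exists>p. path_from_to E r i p) \<and> (\<nexists>p. graph_cycle E p)"

text \<open>Used only for distinct vertices \<open>r\<close>, \<open>i\<close> of a tree, where the path exists and is unique.\<close>

definition next_vertex :: "'a set set \<Rightarrow> 'a \<Rightarrow> 'a \<Rightarrow> 'a" where
  "next_vertex E r i = (THE p. path_from_to E r i p) ! 1"


text \<open>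
  The polynomial ring over the field \<open>'k\<close> whose set of indeterminates is (all of) the type \<open>'v\<close>.
  A monomial is represented by its exponent vector, of type \<open>'v \<Rightarrow>\<^sub>0 nat\<close>.
\<close>

type_synonym ('v, 'k) mpoly = "('v \<Rightarrow>\<^sub>0 nat) \<Rightarrow>\<^sub>0 'k"

definition monomial :: "('v \<Rightarrow>\<^sub>0 nat) \<Rightarrow> ('v, 'k::field) mpoly" where
  "monomial s = Poly_Mapping.single s 1"

definition var :: "'v \<Rightarrow> ('v, 'k::field) mpoly" where
  "var a = monomial (Poly_Mapping.single a 1)"

definition ideal_generated :: "('v, 'k::field) mpoly set \<Rightarrow> ('v, 'k) mpoly set" where
  "ideal_generated G = genideal class_ring G"

lift_definition exponent_gcd :: "('v \<Rightarrow>\<^sub>0 nat) \<Rightarrow> ('v \<Rightarrow>\<^sub>0 nat) \<Rightarrow> ('v \<Rightarrow>\<^sub>0 nat)"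
  is "\<lambda>s t a. min (s a) (t a)"
proof -
  fix s t :: "'v \<Rightarrow> nat"
  assume "finite {a. s a \<noteq> 0}"
  then show "finite {a. min (s a) (t a) \<noteq> 0}"
    by (rule rev_finite_subset) auto
qed

text \<open>The monomial \<open>s / gcd(s, t)\<close>; the subtraction of exponents never truncates.\<close>

definition cofactor_gcd :: "('v \<Rightarrow>\<^sub>0 nat) \<Rightarrow> ('v \<Rightarrow>\<^sub>0 nat) \<Rightarrow> ('v, 'k::field) mpoly" where
  "cofactor_gcd s t = monomial (s - exponent_gcd s t)"


text \<open>
  In the following, generators and vertices are numbered \<open>1, \<dots>, m + 1\<close>, whereas the coordinates
  of vectors and the rows and columns of matrices in the library start at 0. Thus the
  generator or vertex \<open>i\<close> corresponds to the coordinate or column \<open>i - 1\<close>.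
\<close>

definition minimal_monomial_generators ::
    "nat \<Rightarrow> ('v, 'k::field) mpoly set \<Rightarrow> (nat \<Rightarrow> ('v \<Rightarrow>\<^sub>0 nat)) \<Rightarrow> bool" where
  "minimal_monomial_generators n I u \<longleftrightarrow>
     ideal_generated ((\<lambda>i. monomial (u i)) ` {1..n}) = I \<and>
     (\<forall>k\<in>{1..n}. ideal_generated ((\<lambda>i. monomial (u i)) ` ({1..n} - {k})) \<noteq> I)"

definition basis_vec :: "nat \<Rightarrow> nat \<Rightarrow> ('v, 'k::field) mpoly vec" where
  "basis_vec n i = unit_vec n (i - 1)"

definition syzygies ::
    "nat \<Rightarrow> (nat \<Rightarrow> ('v \<Rightarrow>\<^sub>0 nat)) \<Rightarrow> ('v, 'k::field) mpoly vec set" where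
  "syzygies n u = {w \<in> carrier_vec n. (\<Sum>i=1..n. w $ (i - 1) * monomial (u i)) = 0}"

definition taylor_relation ::
    "nat \<Rightarrow> (nat \<Rightarrow> ('v \<Rightarrow>\<^sub>0 nat)) \<Rightarrow> nat \<Rightarrow> nat \<Rightarrow> ('v, 'k::field) mpoly vec" where
  "taylor_relation n u i j =
     cofactor_gcd (u i) (u j) \<cdot>\<^sub>v basis_vec n j - cofactor_gcd (u j) (u i) \<cdot>\<^sub>v basis_vec n i"

definition submodule_generated ::
    "nat \<Rightarrow> ('v, 'k::field) mpoly vec set \<Rightarrow> ('v, 'k) mpoly vec set" where
  "submodule_generated n W =
     LinearCombinations.module.span class_ring (module_vec TYPE(('v, 'k) mpoly) n) W"

text \<open>
  Hilbert-Burch matrices of an ideal \<open>I\<close> with minimal monomial generators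
  \<open>u 1, \<dots>, u (m + 1)\<close>. The notion is meant for Cohen-Macaulay monomial ideals of codimension 2,
  for which the module of syzygies is free of rank \<open>m\<close>, so that the last two conjuncts say that the
  rows are a basis; the definition itself makes sense for every monomial ideal.
\<close>

definition hilbert_burch_matrix ::
    "nat \<Rightarrow> ('v, 'k::field) mpoly set \<Rightarrow> (nat \<Rightarrow> ('v \<Rightarrow>\<^sub>0 nat)) \<Rightarrow> ('v, 'k) mpoly mat \<Rightarrow> bool" where
  "hilbert_burch_matrix m I u H \<longleftrightarrow>
     minimal_monomial_generators (m + 1) I u \<and>
     H \<in> carrier_mat m (m + 1) \<and>
     (\<forall>k<m. \<exists>i j. 1 \<le> i \<and> i < j \<and> j \<le> m + 1 \<and> row H k = taylor_relation (m + 1) u i j) \<and>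
     submodule_generated (m + 1) (row H ` {..<m}) = syzygies (m + 1) u \<and>
     (\<forall>k<m. submodule_generated (m + 1) (row H ` ({..<m} - {k})) \<noteq> syzygies (m + 1) u)"

definition relation_graph ::
    "nat \<Rightarrow> (nat \<Rightarrow> ('v \<Rightarrow>\<^sub>0 nat)) \<Rightarrow> ('v, 'k::field) mpoly mat \<Rightarrow> nat set set" where
  "relation_graph m u H =
     {{i, j} | i j. 1 \<le> i \<and> i < j \<and> j \<le> m + 1 \<and>
        (\<exists>k<m. row H k = taylor_relation (m + 1) u i j)}"

text \<open>The graphs all have vertex set \<open>{1..m+1}\<close> and are identified with their edge sets.\<close>

definition relation_trees ::
    "nat \<Rightarrow> ('v, 'k::field) mpoly set \<Rightarrow> (nat \<Rightarrow> ('v \<Rightarrow>\<^sub>0 nat)) \<Rightarrow> nat set set set" where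
  "relation_trees m I u = {relation_graph m u H | H. hilbert_burch_matrix m I u H}"


text \<open>
  The generic monomial ideal of a tree on \<open>{1..m+1}\<close> with set of edges \<open>E\<close>, or with list of
  edges \<open>es\<close>. Here \<open>x i j\<close> is the element of \<open>'v\<close> that indexes the indeterminate
  \<open>x\<^sub>i\<^sub>j\<close>; in the edge \<open>{i, j}\<close> with \<open>i < j\<close>, \<open>i\<close> is the minimum and \<open>j\<close> the maximum.
\<close>

definition generic_matrix ::
    "nat \<Rightarrow> nat set list \<Rightarrow> (nat \<Rightarrow> nat \<Rightarrow> 'v) \<Rightarrow> ('v, 'k::field) mpoly mat" where
  "generic_matrix m es x = mat m (m + 1) (\<lambda>(k, c).
     let i = Min (es ! k); j = Max (es ! k); l = c + 1 in
     if l = i then - var (x i j) else if l = j then var (x j i) else 0)"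

definition maximal_minor :: "('v, 'k::field) mpoly mat \<Rightarrow> nat \<Rightarrow> ('v, 'k) mpoly" where
  "maximal_minor A i = det (submatrix A UNIV (- {i - 1}))"

definition generic_ideal ::
    "nat \<Rightarrow> nat set list \<Rightarrow> (nat \<Rightarrow> nat \<Rightarrow> 'v) \<Rightarrow> ('v, 'k::field) mpoly set" where
  "generic_ideal m es x = ideal_generated (maximal_minor (generic_matrix m es x) ` {1..m + 1})"

text \<open>
  Exponent vector of the monomial \<open>v\<^sub>i\<close>, the product of the indeterminates \<open>x r (b(r,i))\<close>,
  which is up to sign the maximal minor omitting column \<open>i\<close>.
\<close>

definition generic_generator ::
    "nat \<Rightarrow> nat set set \<Rightarrow> (nat \<Rightarrow> nat \<Rightarrow> 'v) \<Rightarrow> nat \<Rightarrow> ('v \<Rightarrow>\<^sub>0 nat)" where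
  "generic_generator m E x i =
     (\<Sum>r\<in>{1..m + 1} - {i}. Poly_Mapping.single (x r (next_vertex E r i)) 1)"

end

theory Submission
  imports Defs
begin

text \<open>
  Let \<open>b(r,i)\<close> be the vertex after \<open>r\<close> on the path from \<open>r\<close> to \<open>i\<close>. Everything rests on the exponent
  of \<open>v\<^sub>i\<close> at the indeterminate \<open>x\<^sub>r\<^sub>s\<close>: it is \<open>1\<close> if \<open>r \<noteq> i\<close> and \<open>b(r,i) = s\<close>, and
  \<open>0\<close> otherwise (\<open>lookup_v\<close>). For an edge \<open>{i,j}\<close> this gives \<open>v\<^sub>i / gcd(v\<^sub>i, v\<^sub>j) = x\<^sub>j\<^sub>i\<close>, so that the
  Taylor relations of the edges are the rows of the generic matrix.

  Why every relation tree contains all edges: the least common multiple of \<open>v\<^sub>i\<close> and \<open>v\<^sub>j\<close>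
  is \<open>v\<^sub>j x\<^sub>j\<^sub>i\<close>. A generator \<open>v\<^sub>k\<close> with \<open>k \<noteq> i, j\<close> contains an indeterminate of \<open>i\<close> and
  one of \<open>j\<close>; if it divided this monomial, they would have to be \<open>x\<^sub>i\<^sub>j\<close> and \<open>x\<^sub>j\<^sub>i\<close>, and then \<open>k\<close> would
  lie on both sides of the edge. So only \<open>v\<^sub>i\<close> and \<open>v\<^sub>j\<close> divide it, and for this reason the
  relation of \<open>i\<close> and \<open>j\<close> belongs to every generating set of Taylor relations
  (\<open>edge_relation_indispensable\<close>). As the tree has \<open>m\<close> edges and a Hilbert-Burch
  matrix has \<open>m\<close> rows, there are no further edges.

  Why the generic matrix is a Hilbert-Burch matrix: its rows generate the syzygies by induction on the
  support (\<open>syzygy_in_span_of_edge_relations\<close>). If \<open>l\<close> is a vertex of the support of a syzygy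
  \<open>w\<close> that is farthest from the root \<open>1\<close>, and \<open>p = b(l,1)\<close>, then \<open>x\<^sub>l\<^sub>p\<close> divides all
  other \<open>v\<^sub>k\<close> that occur but not \<open>v\<^sub>l\<close>, so it divides \<open>w\<^sub>l\<close>, and a multiple of the relation of
  \<open>l\<close> and \<open>p\<close> cancels this coordinate. No row can be omitted, by the indispensability above. Finally, the
  \<open>v\<^sub>i\<close> are minimal generators of the generic ideal, because the Leibniz expansion of a
  maximal minor has exactly one nonzero term (\<open>maximal_minor_eq\<close>).
\<close>

section \<open>Paths in trees\<close>

lemma vertex_path_iff:
  "vertex_path E p \<longleftrightarrow> p \<noteq> [] \<and> distinct p \<and> successively (\<lambda>a b. {a, b} \<in> E) p"
proof -
  have "(\<forall>k. Suc k < length p \<longrightarrow> P (p ! k) (p ! Suc k)) \<longleftrightarrow> successively P p" for P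
  proof (induction P p rule: successively.induct)
    case (3 P x y xs)
    have "(\<forall>k. Suc k < length (x # y # xs) \<longrightarrow> P ((x # y # xs) ! k) ((x # y # xs) ! Suc k)) \<longleftrightarrow>
        P x y \<and> (\<forall>k. Suc k < length (y # xs) \<longrightarrow> P ((y # xs) ! k) ((y # xs) ! Suc k))"
      by (auto simp: nth_Cons split: nat.splits)
    then show ?case using 3 by simp
  qed auto
  from this[of "\<lambda>a b. {a, b} \<in> E"] show ?thesis by (simp add: vertex_path_def)
qed

lemma path_from_to_Cons:
  "path_from_to E r i (r # s # p) \<longleftrightarrow>
     {r, s} \<in> E \<and> r \<notin> set (s # p) \<and> path_from_to E s i (s # p)"
  by (auto simp: path_from_to_def vertex_path_iff)

lemma path_from_to_hd: "path_from_to E r i p \<Longrightarrow> \<exists>q. p = r # q"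
  by (cases p) (auto simp: path_from_to_def vertex_path_iff)

lemma path_from_to_suffix:
  "path_from_to E r i (q @ s # p) \<Longrightarrow> path_from_to E s i (s # p)"
  by (auto simp: path_from_to_def vertex_path_iff successively_append_iff)

lemma path_from_to_append1:
  assumes "path_from_to E r i p" "{i, j} \<in> E" "j \<notin> set p"
  shows "path_from_to E r j (p @ [j])"
  using assms by (auto simp: path_from_to_def vertex_path_iff successively_append_iff)

text \<open>
  Two different paths with the same ends contain a cycle: strip the common beginning; behind it
  the paths leave the vertex \<open>a\<close> in different directions, and the first vertex of one path that lies
  on the other one closes the cycle.
\<close>

lemma two_paths_cycle:
  assumes "path_from_to E a b p" "path_from_to E a b q" "p \<noteq> q"
  shows "\<exists>c. graph_cycle E c"
  using assms
proof (induction p arbitrary: a q)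
  case Nil
  then show ?case by (simp add: path_from_to_def vertex_path_iff)
next
  case (Cons a' p')
  have [simp]: "a' = a" using Cons.prems(1) by (simp add: path_from_to_def)
  obtain q' where q: "q = a # q'" using path_from_to_hd[OF Cons.prems(2)] by blast
  have *: "a \<notin> set p'" "a \<notin> set q'" "last (a # p') = b" "last (a # q') = b" "p' \<noteq> q'"
    using Cons.prems by (auto simp: path_from_to_def vertex_path_iff q)
  then have ne: "p' \<noteq> []" "q' \<noteq> []"
    by (metis last.simps last_in_set)+
  show ?case
  proof (cases "hd p' = hd q'")
    case True
    have "path_from_to E (hd p') b p'" "path_from_to E (hd p') b q'"
      using Cons.prems ne by (auto simp: q path_from_to_def vertex_path_iff successively_Cons True)
    then show ?thesis using Cons.IH Cons.prems(3) q by auto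
  next
    case False
    have "b \<in> set p'" "b \<in> set q'"
      using * ne last_in_set[of p'] last_in_set[of q'] by auto
    then have "\<exists>c\<in>set p'. c \<in> set q'" by blast
    then obtain p1 c p2 where p1: "p' = p1 @ c # p2" "c \<in> set q'" "\<forall>y\<in>set p1. y \<notin> set q'"
      by (rule split_list_first_propE)
    obtain q1 q2 where q1: "q' = q1 @ c # q2" using split_list[OF p1(2)] by blast
    have "graph_cycle E (a # p1 @ [c] @ rev q1)"
      unfolding graph_cycle_def
    proof (intro conjI)
      show "vertex_path E (a # p1 @ [c] @ rev q1)"
        using Cons.prems p1 ne
        by (auto simp: q q1 path_from_to_def vertex_path_iff successively_append_iff
            successively_Cons insert_commute last_rev hd_rev hd_append)
      show "length (a # p1 @ [c] @ rev q1) \<ge> 3"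
        using False p1 q1 by (cases p1; cases q1) auto
      show "{last (a # p1 @ [c] @ rev q1), hd (a # p1 @ [c] @ rev q1)} \<in> E"
        using Cons.prems(2) ne
        by (cases q1) (auto simp: q q1 path_from_to_def vertex_path_iff insert_commute)
    qed
    then show ?thesis by blast
  qed
qed

locale tree =
  fixes V :: "'a set" and E :: "'a set set"
  assumes tree: "tree_graph V E"
begin

abbreviation path_length :: "'a \<Rightarrow> 'a \<Rightarrow> nat" where
  "path_length r i \<equiv> length (THE p. path_from_to E r i p)"

lemma finite_V: "finite V"
  using tree by (simp add: tree_graph_def simple_graph_def)

lemma edgeD: "{r, s} \<in> E \<Longrightarrow> r \<in> V \<and> s \<in> V \<and> r \<noteq> s"
  using tree by (force simp: tree_graph_def simple_graph_def doubleton_eq_iff)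

lemma edgeE:
  assumes "e \<in> E"
  obtains r s where "e = {r, s}" "r \<in> V" "s \<in> V" "r \<noteq> s"
  using assms tree unfolding tree_graph_def simple_graph_def by blast

lemma path_exists: "r \<in> V \<Longrightarrow> i \<in> V \<Longrightarrow> \<exists>p. path_from_to E r i p"
  using tree by (simp add: tree_graph_def)

lemma path_unique: "path_from_to E r i p \<Longrightarrow> path_from_to E r i q \<Longrightarrow> p = q"
  using tree two_paths_cycle unfolding tree_graph_def by metis

lemma the_path: "path_from_to E r i p \<Longrightarrow> (THE p. path_from_to E r i p) = p"
  using path_unique by blast

lemma next_vertex_eq: "path_from_to E r i (r # s # p) \<Longrightarrow> next_vertex E r i = s"
  by (simp add: next_vertex_def the_path)

lemma path_cases:
  assumes "r \<in> V" "i \<in> V" "r \<noteq> i"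
  obtains p where "path_from_to E r i (r # next_vertex E r i # p)"
proof -
  obtain p where p: "path_from_to E r i p" using path_exists[OF assms(1,2)] by (rule exE)
  obtain q where q: "p = r # q" using path_from_to_hd[OF p] by (rule exE)
  with p assms(3) obtain s q' where "q = s # q'"
    by (cases q) (auto simp: path_from_to_def)
  with p q have "path_from_to E r i (r # s # q')" by simp
  moreover from this have "next_vertex E r i = s" by (rule next_vertex_eq)
  ultimately show ?thesis using that[of q'] by simp
qed

lemma next_edge: "r \<in> V \<Longrightarrow> i \<in> V \<Longrightarrow> r \<noteq> i \<Longrightarrow> {r, next_vertex E r i} \<in> E"
  by (erule (2) path_cases) (simp add: path_from_to_Cons)

lemma path_length_next:
  assumes "r \<in> V" "i \<in> V" "r \<noteq> i"
  shows "path_length (next_vertex E r i) i < path_length r i"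
proof -
  obtain p where p: "path_from_to E r i (r # next_vertex E r i # p)"
    using path_cases assms by blast
  then have "path_from_to E (next_vertex E r i) i (next_vertex E r i # p)"
    by (simp add: path_from_to_Cons)
  with p show ?thesis by (simp add: the_path)
qed

text \<open>
  Given a target \<open>i\<close>, each edge is traversed in exactly one direction by the paths to \<open>i\<close>: the path
  from \<open>r\<close> either contains the neighbour \<open>s\<close>, and then begins with \<open>r, s\<close>, or extends to a path
  from \<open>s\<close> by prepending \<open>s\<close>.
\<close>

lemma edge_direction:
  assumes "{r, s} \<in> E" "i \<in> V"
  shows "(r \<noteq> i \<and> next_vertex E r i = s) \<longleftrightarrow> \<not> (s \<noteq> i \<and> next_vertex E s i = r)"
proof -
  have rs: "r \<in> V" "s \<in> V" "r \<noteq> s" using edgeD assms(1) by auto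
  obtain P where P: "path_from_to E r i P" using path_exists rs assms by blast
  obtain P' where P': "P = r # P'" using path_from_to_hd[OF P] by blast
  show ?thesis
  proof (cases "s \<in> set P")
    case True
    then obtain q p where qp: "P' = q @ s # p"
      using P' rs split_list by fastforce
    have s: "path_from_to E s i (s # p)"
      using P unfolding P' qp using path_from_to_suffix[of E r i "r # q"] by simp
    have "r \<notin> set (s # p)" using P unfolding P' qp by (auto simp: path_from_to_def vertex_path_iff)
    with s assms have r: "path_from_to E r i (r # s # p)" by (simp add: path_from_to_Cons)
    have "r \<noteq> i" using r by (auto simp: path_from_to_def vertex_path_iff split: if_splits)
    moreover have "\<not> (s \<noteq> i \<and> next_vertex E s i = r)"
    proof
      assume *: "s \<noteq> i \<and> next_vertex E s i = r"
      then obtain p' where "path_from_to E s i (s # r # p')"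
        using path_cases[of s i] rs assms by metis
      from path_unique[OF this s] \<open>r \<notin> set (s # p)\<close> show False by auto
    qed
    ultimately show ?thesis using next_vertex_eq[OF r] by simp
  next
    case False
    with P P' assms(1) have "path_from_to E s i (s # r # P')"
      by (simp add: path_from_to_Cons insert_commute)
    from next_vertex_eq[OF this] have "next_vertex E s i = r" .
    moreover have "s \<noteq> i" using False P by (auto simp: path_from_to_def vertex_path_iff)
    moreover have "\<not> (r \<noteq> i \<and> next_vertex E r i = s)"
    proof
      assume "r \<noteq> i \<and> next_vertex E r i = s"
      then obtain p' where "path_from_to E r i (r # s # p')"
        using path_cases[of r i] rs assms by metis
      from path_unique[OF this P] False show False by auto
    qed
    ultimately show ?thesis by simp
  qed
qed

lemma next_vertex_adjacent_target: "{r, s} \<in> E \<Longrightarrow> next_vertex E r s = s"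
  using edge_direction[of r s s] edgeD by auto

lemma next_vertex_adjacent_targets:
  assumes "{i, j} \<in> E" "r \<in> V" "r \<noteq> i" "r \<noteq> j"
  shows "next_vertex E r i = next_vertex E r j"
proof -
  have ij: "i \<in> V" "j \<in> V" using edgeD assms(1) by auto
  obtain p where p: "path_from_to E r i (r # next_vertex E r i # p)"
    using path_cases assms ij by blast
  show ?thesis
  proof (cases "j \<in> set (r # next_vertex E r i # p)")
    case False
    from next_vertex_eq[of r j, OF path_from_to_append1[OF p assms(1) False, simplified]]
    show ?thesis by simp
  next
    case True
    \<comment> \<open>The path from \<open>r\<close> to \<open>j\<close> is then a prefix of the one to \<open>i\<close>, of length at least two.\<close>
    then obtain q q' where q: "next_vertex E r i # p = q @ j # q'"
      using assms split_list[of j "next_vertex E r i # p"] by auto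
    have "path_from_to E r j (r # q @ [j])"
      using p unfolding q
      by (auto simp: path_from_to_def vertex_path_iff successively_append_iff successively_Cons hd_append)
    moreover obtain q2 where "q @ [j] = next_vertex E r i # q2"
      using q by (cases q) auto
    ultimately have "path_from_to E r j (r # next_vertex E r i # q2)" by simp
    then show ?thesis by (rule next_vertex_eq[symmetric])
  qed
qed

text \<open>
  A path from \<open>l\<close> that does not start towards \<open>z\<close> goes away from \<open>z\<close> all the time: the
  last vertex \<open>k\<close> has a predecessor on the path, which is the next vertex from \<open>k\<close> towards \<open>z\<close>.
\<close>

lemma path_length_away:
  assumes "z \<in> V" "l \<in> V" "l \<noteq> z" "k \<in> V" "k \<noteq> l"
    and "next_vertex E l k \<noteq> next_vertex E l z"
  shows "path_length l z < path_length k z"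
  using assms(4-)
proof (induction "path_length k z" arbitrary: k rule: less_induct)
  case less
  have kr: "k \<noteq> z" using less.prems by auto
  define k' where "k' = next_vertex E k z"
  have e: "{k, k'} \<in> E" using next_edge less.prems kr assms k'_def by blast
  then have k'V: "k' \<in> V" using edgeD by blast
  have lt: "path_length k' z < path_length k z"
    using path_length_next less.prems kr assms k'_def by blast
  show ?case
  proof (cases "k' = l")
    case False
    then have "next_vertex E l k' = next_vertex E l k"
      using next_vertex_adjacent_targets[OF e] less.prems assms by auto
    with less.hyps[OF lt k'V False] less.prems lt show ?thesis by simp
  qed (use lt in simp)
qed

text \<open>
  Choose for every vertex other than \<open>i\<close> an edge at this vertex, all these edges being different.
  If the edge chosen for \<open>r\<close> is not the first edge on the path to \<open>i\<close>, then it is the first edge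
  for its other end \<open>s\<close>, which is farther from \<open>i\<close> and cannot use this edge again. So a
  farthest such \<open>r\<close> does not exist.
\<close>

lemma incident_edge_choice_unique:
  assumes i: "i \<in> V"
    and f: "inj_on f (V - {i})" "\<And>r. r \<in> V - {i} \<Longrightarrow> f r \<in> E \<and> r \<in> f r"
    and r: "r \<in> V - {i}"
  shows "f r = {r, next_vertex E r i}"
proof (rule ccontr)
  define B where "B = {r \<in> V - {i}. f r \<noteq> {r, next_vertex E r i}}"
  assume "f r \<noteq> {r, next_vertex E r i}"
  then have "B \<noteq> {}" "finite B" using r finite_V by (auto simp: B_def)
  then have "Max ((\<lambda>s. path_length s i) ` B) \<in> (\<lambda>s. path_length s i) ` B"
    by (intro Max_in) auto
  then obtain r where r: "r \<in> B" "path_length r i = Max ((\<lambda>s. path_length s i) ` B)"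
    by auto
  have r_max: "path_length s i \<le> path_length r i" if "s \<in> B" for s
    unfolding r(2) using that \<open>finite B\<close> by (intro Max_ge) auto
  from r have rV: "r \<in> V" "r \<noteq> i" by (auto simp: B_def)
  obtain s where s: "f r = {r, s}"
    using f(2)[of r] rV by (metis Diff_iff doubleton_eq_iff edgeE insert_iff singletonD)
  have rs: "{r, s} \<in> E" using f(2)[of r] rV s by simp
  have "next_vertex E r i \<noteq> s" using r s by (auto simp: B_def)
  with edge_direction[OF rs i] have si: "s \<noteq> i" "next_vertex E s i = r" by auto
  have sV: "s \<in> V" "s \<noteq> r" using edgeD[OF rs] by auto
  have "path_length r i < path_length s i" using path_length_next[of s i] si sV i by simp
  then have "s \<notin> B" using r_max[of s] by linarith
  then have "f s = {r, s}" using sV si by (auto simp: B_def)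
  then show False using f(1) s sV si rV by (auto simp: inj_on_def)
qed

text \<open>
  By \<open>edge_direction\<close> every edge is the first edge on the path to \<open>i\<close> from exactly one of its ends.
\<close>

lemma bij_betw_first_edge:
  assumes i: "i \<in> V"
  shows "bij_betw (\<lambda>r. {r, next_vertex E r i}) (V - {i}) E"
  unfolding bij_betw_def
proof
  show "inj_on (\<lambda>r. {r, next_vertex E r i}) (V - {i})"
  proof (rule inj_onI, rule ccontr)
    fix r s assume *: "r \<in> V - {i}" "s \<in> V - {i}" "{r, next_vertex E r i} = {s, next_vertex E s i}" "r \<noteq> s"
    then have "next_vertex E r i = s" "next_vertex E s i = r" by (auto simp: doubleton_eq_iff)
    then show False using edge_direction[of r s i] next_edge[of r i] * i by auto
  qed
  show "(\<lambda>r. {r, next_vertex E r i}) ` (V - {i}) = E"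
  proof
    show "(\<lambda>r. {r, next_vertex E r i}) ` (V - {i}) \<subseteq> E" using next_edge i by auto
    show "E \<subseteq> (\<lambda>r. {r, next_vertex E r i}) ` (V - {i})"
    proof
      fix e assume e: "e \<in> E"
      then obtain r s where rs: "e = {r, s}" "r \<in> V" "s \<in> V" by (rule edgeE)
      consider "r \<noteq> i" "next_vertex E r i = s" | "s \<noteq> i" "next_vertex E s i = r"
        using edge_direction[of r s i] i e rs by auto
      then show "e \<in> (\<lambda>r. {r, next_vertex E r i}) ` (V - {i})"
      proof cases
        case 1
        with rs show ?thesis by auto
      next
        case 2
        with rs have "s \<in> V - {i}" "e = {s, next_vertex E s i}" by auto
        then show ?thesis by blast
      qed
    qed
  qed
qed

lemma card_edges: "card E = card V - 1"
proof -
  obtain i where i: "i \<in> V" using tree unfolding tree_graph_def by blast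
  have "card (V - {i}) = card E" by (rule bij_betw_same_card[OF bij_betw_first_edge[OF i]])
  with i show ?thesis by simp
qed

end

section \<open>Monomial ideals and submodules\<close>

lemma keys_monomial [simp]: "Poly_Mapping.keys (monomial s :: ('v, 'k::field) mpoly) = {s}"
  by (simp add: monomial_def)

lemma monomial_mult: "monomial s * monomial t = (monomial (s + t) :: ('v, 'k::field) mpoly)"
  by (simp add: monomial_def mult_single)

lemma monomial_nonzero: "monomial s \<noteq> (0 :: ('v, 'k::field) mpoly)"
  by (metis keys_monomial keys_zero insert_not_empty)

lemma prod_var: "(\<Prod>a\<in>A. var (f a) :: ('v, 'k::field) mpoly) = monomial (\<Sum>a\<in>A. Poly_Mapping.single (f a) 1)"
  by (induction A rule: infinite_finite_induct) (auto simp: var_def monomial_mult, auto simp: monomial_def)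

lemma sum_of_terms:
  "(\<Sum>t\<in>Poly_Mapping.keys p. Poly_Mapping.single t (Poly_Mapping.lookup p t)) = p"
  by (rule poly_mapping_eqI)
    (auto simp: lookup_sum lookup_single when_def sum.delta in_keys_iff)

lemma lookup_mult_monomial:
  "Poly_Mapping.lookup (p * monomial s) (t + s) = Poly_Mapping.lookup (p :: ('v, 'k::field) mpoly) t"
proof -
  have "p * monomial s =
      (\<Sum>t'\<in>Poly_Mapping.keys p. Poly_Mapping.single (t' + s) (Poly_Mapping.lookup p t'))"
    by (subst (1) sum_of_terms[of p, symmetric])
      (simp add: sum_distrib_right monomial_def mult_single)
  then show ?thesis
    by (auto simp: lookup_sum lookup_single when_def sum.delta in_keys_iff)
qed

lemma mult_monomial_eq_0_iff: "p * monomial s = 0 \<longleftrightarrow> (p :: ('v, 'k::field) mpoly) = 0"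
  by (metis lookup_mult_monomial lookup_zero mult_zero_left poly_mapping_eqI)

lemma divisible_by_monomial:
  assumes "\<And>t. t \<in> Poly_Mapping.keys p \<Longrightarrow> \<exists>t'. t = t' + s"
  shows "\<exists>q. (p :: ('v, 'k::field) mpoly) = q * monomial s"
proof
  have "(\<Sum>t\<in>Poly_Mapping.keys p. Poly_Mapping.single (t - s) (Poly_Mapping.lookup p t)) * monomial s =
      (\<Sum>t\<in>Poly_Mapping.keys p. Poly_Mapping.single t (Poly_Mapping.lookup p t))"
    unfolding sum_distrib_right
  proof (rule sum.cong)
    fix t assume "t \<in> Poly_Mapping.keys p"
    with assms obtain t' where "t = t' + s" by blast
    then show "Poly_Mapping.single (t - s) (Poly_Mapping.lookup p t) * monomial s =
        Poly_Mapping.single t (Poly_Mapping.lookup p t)"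
      by (simp add: monomial_def mult_single)
  qed simp
  then show "p = (\<Sum>t\<in>Poly_Mapping.keys p. Poly_Mapping.single (t - s) (Poly_Mapping.lookup p t)) * monomial s"
    by (simp add: sum_of_terms)
qed

lemma single_divides_exponent:
  assumes "Poly_Mapping.lookup t a \<ge> 1"
  shows "\<exists>t'. t = t' + Poly_Mapping.single a (1::nat)"
proof
  show "t = (t - Poly_Mapping.single a 1) + Poly_Mapping.single a 1"
    by (rule poly_mapping_eqI) (use assms in \<open>auto simp: lookup_add lookup_minus lookup_single when_def\<close>)
qed

lemma keys_multE:
  assumes "t \<in> Poly_Mapping.keys (p * q)"
  obtains a b where "a \<in> Poly_Mapping.keys p" "b \<in> Poly_Mapping.keys q" "t = a + b"
  using assms keys_mult[of p q] by blast

lemma ideal_ideal_generated: "ideal (ideal_generated G :: ('v, 'k::field) mpoly set) class_ring"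
  unfolding ideal_generated_def by (rule ring.genideal_ideal[OF class_ring.ring_axioms]) simp

lemma ideal_generated_superset: "G \<subseteq> (ideal_generated G :: ('v, 'k::field) mpoly set)"
  unfolding ideal_generated_def by (rule ring.genideal_self[OF class_ring.ring_axioms]) simp

lemma ideal_generated_minimal:
  "ideal I class_ring \<Longrightarrow> G \<subseteq> I \<Longrightarrow> (ideal_generated G :: ('v, 'k::field) mpoly set) \<subseteq> I"
  unfolding ideal_generated_def by (rule ring.genideal_minimal[OF class_ring.ring_axioms])

lemma ideal_generated_uminus:
  assumes "g \<in> (ideal_generated G :: ('v, 'k::field) mpoly set)"
  shows "- g \<in> ideal_generated G"
  using ideal.I_l_closed[OF ideal_ideal_generated assms, of "- 1"] by (simp add: class_ring_simps)

lemma ideal_generated_cong_sign: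
  fixes f g :: "'i \<Rightarrow> ('v, 'k::field) mpoly"
  assumes "\<And>i. i \<in> A \<Longrightarrow> f i = g i \<or> f i = - g i"
  shows "ideal_generated (f ` A) = ideal_generated (g ` A)"
proof -
  have "ideal_generated (f ` A) \<subseteq> ideal_generated (g ` A)"
    if "\<And>i. i \<in> A \<Longrightarrow> f i = g i \<or> f i = - g i" for f g :: "'i \<Rightarrow> ('v, 'k) mpoly"
  proof (rule ideal_generated_minimal[OF ideal_ideal_generated], clarify)
    fix i assume i: "i \<in> A"
    then have "g i \<in> ideal_generated (g ` A)" using ideal_generated_superset by blast
    with that[OF i] show "f i \<in> ideal_generated (g ` A)" using ideal_generated_uminus by auto
  qed
  from this[of f g] this[of g f] assms show ?thesis by (metis equation_minus_iff subset_antisym)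
qed

text \<open>
  The polynomials all of whose terms are divisible by some monomial from \<open>L\<close> form an ideal.
\<close>

lemma keys_in_monomial_ideal:
  assumes "p \<in> (ideal_generated (monomial ` L) :: ('v, 'k::field) mpoly set)"
    and "t \<in> Poly_Mapping.keys p"
  shows "\<exists>s\<in>L. \<exists>t'. t = t' + s"
proof -
  let ?I = "{p :: ('v, 'k) mpoly. \<forall>t\<in>Poly_Mapping.keys p. \<exists>s\<in>L. \<exists>t'. t = t' + s}"
  have mult: "p * q \<in> ?I" if "p \<in> ?I" for p q
  proof clarify
    fix t assume "t \<in> Poly_Mapping.keys (p * q)"
    then obtain a b where "a \<in> Poly_Mapping.keys p" "b \<in> Poly_Mapping.keys q" "t = a + b"
      by (rule keys_multE)
    moreover from this that obtain s t' where "s \<in> L" "a = t' + s" by blast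
    ultimately have "t = (t' + b) + s" by (simp add: ac_simps)
    with \<open>s \<in> L\<close> show "\<exists>s\<in>L. \<exists>t'. t = t' + s" by blast
  qed
  have "ideal ?I class_ring"
  proof (rule idealI[OF class_ring.ring_axioms])
    show "subgroup ?I (add_monoid class_ring)"
    proof
      show "x \<otimes>\<^bsub>add_monoid class_ring\<^esub> y \<in> ?I" if "x \<in> ?I" "y \<in> ?I" for x y
        using that keys_add[of x y] by (auto simp: class_ring_simps)
      show "inv\<^bsub>add_monoid class_ring\<^esub> x \<in> ?I" if "x \<in> ?I" for x
      proof -
        have "inv\<^bsub>add_monoid class_ring\<^esub> x = \<ominus>\<^bsub>class_ring\<^esub> x" by (simp only: a_inv_def)
        also have "\<dots> = x * (- 1)" by (simp add: class_ring_simps)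
        finally show ?thesis using mult[OF that] by (simp only:)
      qed
    qed (auto simp: class_ring_simps)
    show "x \<otimes>\<^bsub>class_ring\<^esub> a \<in> ?I" if "a \<in> ?I" for a x
      using mult[OF that, of x] by (simp add: class_ring_simps mult.commute)
    show "a \<otimes>\<^bsub>class_ring\<^esub> x \<in> ?I" if "a \<in> ?I" for a x
      using mult[OF that, of x] by (simp add: class_ring_simps)
  qed
  moreover have "monomial ` L \<subseteq> ?I" by (auto intro!: bexI[rotated] exI[of _ 0])
  ultimately have "ideal_generated (monomial ` L) \<subseteq> ?I" by (rule ideal_generated_minimal)
  with assms show ?thesis by auto
qed

lemma submodule_generated_minimal:
  fixes N :: "('v, 'k::field) mpoly vec set"
  assumes "W \<subseteq> N" "N \<subseteq> carrier_vec n" "0\<^sub>v n \<in> N"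
    and "\<And>u v. u \<in> N \<Longrightarrow> v \<in> N \<Longrightarrow> u + v \<in> N"
    and "\<And>c v. v \<in> N \<Longrightarrow> c \<cdot>\<^sub>v v \<in> N"
  shows "submodule_generated n W \<subseteq> N"
proof -
  interpret vec_module "TYPE(('v, 'k) mpoly)" n .
  have "submodule class_ring N V"
    by (rule submodule.intro[OF module_axioms[unfolded class_ring_simps]])
      (use assms in \<open>auto simp: module_vec_simps\<close>)
  with span_is_subset[of W N] assms show ?thesis unfolding submodule_generated_def by blast
qed

lemma submodule_generated_closed:
  fixes W :: "('v, 'k::field) mpoly vec set"
  assumes "W \<subseteq> carrier_vec n"
  shows "W \<subseteq> submodule_generated n W"
    and "0\<^sub>v n \<in> submodule_generated n W"
    and "u \<in> submodule_generated n W \<Longrightarrow> v \<in> submodule_generated n W \<Longrightarrow> u + v \<in> submodule_generated n W"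
    and "v \<in> submodule_generated n W \<Longrightarrow> c \<cdot>\<^sub>v v \<in> submodule_generated n W"
proof -
  interpret vec_module "TYPE(('v, 'k) mpoly)" n .
  interpret S: submodule class_ring "span W" V
    using span_is_submodule assms by blast
  show "W \<subseteq> submodule_generated n W"
    using in_own_span assms unfolding submodule_generated_def by blast
  show "0\<^sub>v n \<in> submodule_generated n W"
    using S.zero_closed unfolding submodule_generated_def by (simp add: module_vec_simps)
  show "u \<in> submodule_generated n W \<Longrightarrow> v \<in> submodule_generated n W \<Longrightarrow> u + v \<in> submodule_generated n W"
    using S.m_closed unfolding submodule_generated_def by (simp add: module_vec_simps)
  show "v \<in> submodule_generated n W \<Longrightarrow> c \<cdot>\<^sub>v v \<in> submodule_generated n W"
    using S.smult_closed unfolding submodule_generated_def by (simp add: module_vec_simps)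
qed

text \<open>
  The vectors whose terms in coordinate \<open>c\<close> are such multiples form a submodule that contains \<open>W\<close>.
  This takes the place of a comparison of multidegrees: to produce a monomial in some coordinate, one
  of the combined vectors must have a divisor of this monomial among its terms there.
\<close>

lemma keys_in_submodule_generated:
  fixes W :: "('v, 'k::field) mpoly vec set"
  assumes "W \<subseteq> carrier_vec n" "w \<in> submodule_generated n W" "c < n" "t \<in> Poly_Mapping.keys (w $ c)"
  shows "\<exists>y\<in>W. \<exists>s\<in>Poly_Mapping.keys (y $ c). \<exists>t'. t = t' + s"
proof -
  let ?N = "{w \<in> carrier_vec n. \<forall>t\<in>Poly_Mapping.keys (w $ c).
      \<exists>y\<in>W. \<exists>s\<in>Poly_Mapping.keys (y $ c). \<exists>t'. t = t' + s}"
  have "submodule_generated n W \<subseteq> ?N"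
  proof (rule submodule_generated_minimal)
    show "W \<subseteq> ?N" using assms(1) by (auto intro!: bexI[rotated] exI[of _ 0])
    show "u + v \<in> ?N" if "u \<in> ?N" "v \<in> ?N" for u v
      using that keys_add[of "u $ c" "v $ c"] assms(3) by auto
    show "d \<cdot>\<^sub>v v \<in> ?N" if "v \<in> ?N" for d v
    proof -
      have "\<exists>y\<in>W. \<exists>s\<in>Poly_Mapping.keys (y $ c). \<exists>t'. t = t' + s"
        if t: "t \<in> Poly_Mapping.keys ((d \<cdot>\<^sub>v v) $ c)" for t
      proof -
        have "t \<in> Poly_Mapping.keys (d * v $ c)" using t \<open>v \<in> ?N\<close> assms(3) by auto
        then obtain a b where ab: "b \<in> Poly_Mapping.keys (v $ c)" "t = a + b" by (rule keys_multE)
        with \<open>v \<in> ?N\<close> obtain y s t' where y: "y \<in> W" "s \<in> Poly_Mapping.keys (y $ c)" "b = t' + s" by blast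
        with ab have "t = (a + t') + s" by (simp add: ac_simps)
        with y show ?thesis by blast
      qed
      with that show ?thesis by auto
    qed
  qed (use assms(3) in auto)
  with assms show ?thesis by auto
qed

lemma card_omit:
  assumes "i \<in> {1..m + 1}"
  shows "card {a. a < m + 1 \<and> a \<in> - {i - 1}} = m"
proof -
  have set: "{a. a < m + 1 \<and> a \<in> - {i - 1}} = {..<m + 1} - {i - 1}" by auto
  show ?thesis using assms unfolding set by (subst card_Diff_singleton) auto
qed

lemma bij_betw_pick_omit:
  assumes "i \<in> {1..m + 1}"
  shows "bij_betw (\<lambda>c. Suc (pick (- {i - 1}) c)) {0..<m} ({1..m + 1} - {i})"
proof -
  have inf: "infinite (- {i - 1} :: nat set)" by (simp add: Compl_eq_Diff_UNIV)
  note card = card_omit[OF assms]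
  have inj: "inj_on (\<lambda>c. Suc (pick (- {i - 1}) c)) {0..<m}"
    using pick_eq_iff_inf[OF inf] by (auto simp: inj_on_def)
  have sub: "(\<lambda>c. Suc (pick (- {i - 1}) c)) ` {0..<m} \<subseteq> {1..m + 1} - {i}"
  proof clarify
    fix c assume "c \<in> {0..<m}"
    then have "pick (- {i - 1}) c < m + 1" by (intro pick_le) (simp only: card, simp)
    with pick_in_set_inf[OF inf, of c] assms show "Suc (pick (- {i - 1}) c) \<in> {1..m + 1} - {i}"
      by auto
  qed
  have "(\<lambda>c. Suc (pick (- {i - 1}) c)) ` {0..<m} = {1..m + 1} - {i}"
    using assms by (intro card_subset_eq[OF _ sub]) (simp_all only: card_image[OF inj], simp_all)
  with inj show ?thesis by (simp add: bij_betw_def)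
qed

lemma prod_cong_sign:
  fixes f g :: "'i \<Rightarrow> 'r::comm_ring_1"
  assumes "\<And>i. i \<in> A \<Longrightarrow> f i = g i \<or> f i = - g i"
  shows "prod f A = prod g A \<or> prod f A = - prod g A"
  using assms by (induction A rule: infinite_finite_induct) fastforce+

section \<open>Taylor relations\<close>

lemma lookup_exponent_gcd:
  "Poly_Mapping.lookup (exponent_gcd s t) a = min (Poly_Mapping.lookup s a) (Poly_Mapping.lookup t a)"
  by (simp add: exponent_gcd.rep_eq)

lemma cofactor_gcd_mult_commute:
  "cofactor_gcd s t * monomial t = (cofactor_gcd t s * monomial s :: ('v, 'k::field) mpoly)"
proof -
  have "s - exponent_gcd s t + t = t - exponent_gcd t s + s"
    by (rule poly_mapping_eqI) (simp add: lookup_add lookup_minus lookup_exponent_gcd)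
  then show ?thesis by (simp add: cofactor_gcd_def monomial_mult)
qed

lemma taylor_relation_carrier [simp]: "taylor_relation n u i j \<in> carrier_vec n"
  by (simp add: taylor_relation_def basis_vec_def)

lemma dim_taylor_relation [simp]: "dim_vec (taylor_relation n u i j) = n"
  by (rule carrier_vecD) simp

lemma taylor_relation_index:
  assumes "i \<in> {1..n}" "j \<in> {1..n}" "i \<noteq> j" "k \<in> {1..n}"
  shows "taylor_relation n u i j $ (k - 1) =
    (if k = j then cofactor_gcd (u i) (u j) else if k = i then - cofactor_gcd (u j) (u i) else 0)"
proof -
  have "k - 1 = j - 1 \<longleftrightarrow> k = j" "k - 1 = i - 1 \<longleftrightarrow> k = i" using assms by auto
  with assms show ?thesis by (auto simp: taylor_relation_def basis_vec_def)
qed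

lemma cofactor_gcd_nonzero: "cofactor_gcd s t \<noteq> (0 :: ('v, 'k::field) mpoly)"
  by (simp add: cofactor_gcd_def monomial_nonzero)

lemma taylor_relation_support:
  assumes "i \<in> {1..n}" "j \<in> {1..n}" "i \<noteq> j"
  shows "{k \<in> {1..n}. taylor_relation n u i j $ (k - 1) \<noteq> (0 :: ('v, 'k::field) mpoly)} = {i, j}"
  using assms by (auto simp: taylor_relation_index cofactor_gcd_nonzero simp del: One_nat_def split: if_splits)

lemma taylor_relation_syzygy:
  assumes "i \<in> {1..n}" "j \<in> {1..n}" "i \<noteq> j"
  shows "(taylor_relation n u i j :: ('v, 'k::field) mpoly vec) \<in> syzygies n u"
proof -
  have "(\<Sum>k=1..n. taylor_relation n u i j $ (k - 1) * monomial (u k) :: ('v, 'k) mpoly) =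
      (\<Sum>k=1..n. (if k = j then cofactor_gcd (u i) (u j) * monomial (u j) else 0) -
        (if k = i then cofactor_gcd (u j) (u i) * monomial (u i) else 0))"
    by (rule sum.cong) (use assms in \<open>auto simp: taylor_relation_index simp del: One_nat_def\<close>)
  also have "\<dots> = 0"
    using assms by (simp add: sum_subtractf cofactor_gcd_mult_commute)
  finally show ?thesis by (simp add: syzygies_def)
qed

lemma syzygies_closed:
  fixes u :: "nat \<Rightarrow> ('v \<Rightarrow>\<^sub>0 nat)"
  shows "0\<^sub>v n \<in> (syzygies n u :: ('v, 'k::field) mpoly vec set)"
    and "w \<in> syzygies n u \<Longrightarrow> w' \<in> syzygies n u \<Longrightarrow> w + w' \<in> (syzygies n u :: ('v, 'k) mpoly vec set)"
    and "w \<in> syzygies n u \<Longrightarrow> c \<cdot>\<^sub>v w \<in> (syzygies n u :: ('v, 'k) mpoly vec set)"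
proof -
  have idx: "k - 1 < n" if "k \<in> {1..n}" for k using that by auto
  show "0\<^sub>v n \<in> (syzygies n u :: ('v, 'k) mpoly vec set)"
    using idx by (simp add: syzygies_def)
  show "w + w' \<in> (syzygies n u :: ('v, 'k) mpoly vec set)"
    if "w \<in> syzygies n u" "w' \<in> syzygies n u"
  proof -
    have "(\<Sum>i = 1..n. (w + w') $ (i - 1) * monomial (u i)) =
        (\<Sum>i = 1..n. w $ (i - 1) * monomial (u i)) + (\<Sum>i = 1..n. w' $ (i - 1) * monomial (u i))"
      unfolding sum.distrib[symmetric]
      by (rule sum.cong) (use that idx in \<open>auto simp: syzygies_def distrib_right\<close>)
    with that show ?thesis by (simp add: syzygies_def)
  qed
  show "c \<cdot>\<^sub>v w \<in> (syzygies n u :: ('v, 'k) mpoly vec set)" if "w \<in> syzygies n u"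
  proof -
    have "(\<Sum>i = 1..n. (c \<cdot>\<^sub>v w) $ (i - 1) * monomial (u i)) =
        c * (\<Sum>i = 1..n. w $ (i - 1) * monomial (u i))"
      unfolding sum_distrib_left
      by (rule sum.cong) (use that idx in \<open>auto simp: syzygies_def mult.assoc\<close>)
    with that show ?thesis by (simp add: syzygies_def)
  qed
qed

text \<open>
  A row of \<open>H\<close> that is a Taylor relation determines its edge as the set of its nonzero coordinates.
\<close>

lemma card_relation_graph_le:
  fixes H :: "('v, 'k::field) mpoly mat"
  shows "finite (relation_graph m u H) \<and> card (relation_graph m u H) \<le> m"
proof -
  let ?supp = "\<lambda>k. {i \<in> {1..m + 1}. row H k $ (i - 1) \<noteq> 0}"
  have "relation_graph m u H \<subseteq> ?supp ` {..<m}"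
  proof
    fix e assume "e \<in> relation_graph m u H"
    then obtain i j k where ijk: "e = {i, j}" "i \<in> {1..m + 1}" "j \<in> {1..m + 1}" "i \<noteq> j"
        "k < m" "row H k = taylor_relation (m + 1) u i j"
      by (auto simp: relation_graph_def)
    have "e = ?supp k" unfolding ijk(1,6) by (rule taylor_relation_support[OF ijk(2-4), symmetric])
    with ijk(5) show "e \<in> ?supp ` {..<m}" by blast
  qed
  then have "finite (relation_graph m u H)" "card (relation_graph m u H) \<le> card (?supp ` {..<m})"
    by (auto intro: finite_subset card_mono)
  moreover have "card (?supp ` {..<m}) \<le> m" using card_image_le[of "{..<m}" ?supp] by simp
  ultimately show ?thesis by simp
qed

section \<open>The exponents of the generators\<close>

locale generic_tree = tree "{1..m + 1}" E for m :: nat and E :: "nat set set" +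
  fixes x :: "nat \<Rightarrow> nat \<Rightarrow> 'v"
  assumes x: "bij_betw (\<lambda>(i, j). x i j) {(i, j). {i, j} \<in> E} (UNIV :: 'v set)"
begin

abbreviation V :: "nat set" where "V \<equiv> {1..m + 1}"

abbreviation v :: "nat \<Rightarrow> ('v \<Rightarrow>\<^sub>0 nat)" where "v \<equiv> generic_generator m E x"

lemma ordered_edgeE:
  assumes "e \<in> E"
  obtains i j where "e = {i, j}" "i \<in> V" "j \<in> V" "i < j"
proof -
  obtain r s where rs: "e = {r, s}" "r \<in> V" "s \<in> V" "r \<noteq> s" using assms by (rule edgeE)
  show thesis
  proof (cases "r < s")
    case True
    with rs show thesis by (intro that[of r s])
  next
    case False
    with rs show thesis by (intro that[of s r]) auto
  qed
qed

lemma x_eq_iff: "{i, j} \<in> E \<Longrightarrow> {k, l} \<in> E \<Longrightarrow> x i j = x k l \<longleftrightarrow> i = k \<and> j = l"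
  using x by (auto simp: bij_betw_def inj_on_def)

lemma indeterminate_cases:
  obtains r s where "{r, s} \<in> E" "a = x r s"
proof -
  have "a \<in> (\<lambda>(i, j). x i j) ` {(i, j). {i, j} \<in> E}" using x by (simp add: bij_betw_def)
  with that show ?thesis by auto
qed

text \<open>
  Since every indeterminate belongs to exactly one pair \<open>r, s\<close> of neighbours, this formula describes
  the exponents of \<open>v\<^sub>i\<close> completely; all divisibility questions below are decided by it.
\<close>

lemma lookup_v:
  assumes "i \<in> V" "{r, s} \<in> E"
  shows "Poly_Mapping.lookup (v i) (x r s) = of_bool (r \<noteq> i \<and> next_vertex E r i = s)"
proof -
  have r: "r \<in> V" using edgeD assms by blast
  have "Poly_Mapping.lookup (v i) (x r s) =
      (\<Sum>k\<in>V - {i}. if k = r then of_bool (next_vertex E r i = s) else 0)"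
    unfolding generic_generator_def lookup_sum
  proof (rule sum.cong)
    fix k assume "k \<in> V - {i}"
    then have "{k, next_vertex E k i} \<in> E" using next_edge assms by blast
    from x_eq_iff[OF this assms(2)]
    show "Poly_Mapping.lookup (Poly_Mapping.single (x k (next_vertex E k i)) 1) (x r s) =
        (if k = r then of_bool (next_vertex E r i = s) else 0)"
      by (auto simp: lookup_single when_def)
  qed simp
  also have "\<dots> = of_bool (r \<noteq> i \<and> next_vertex E r i = s)"
    using r by (subst sum.delta) auto
  finally show ?thesis .
qed

text \<open>
  For neighbours \<open>i\<close> and \<open>j\<close> the paths from any third vertex to \<open>i\<close> and to \<open>j\<close> start in the
  same way, so \<open>v\<^sub>i\<close> and \<open>v\<^sub>j\<close> differ only in the factors contributed by \<open>i\<close> and \<open>j\<close>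
  themselves. Therefore the Taylor relations of the edges are the rows of the generic matrix.
\<close>

lemma cofactor_gcd_edge:
  assumes "{i, j} \<in> E"
  shows "cofactor_gcd (v i) (v j) = (var (x j i) :: ('v, 'k::field) mpoly)"
proof -
  have ij: "i \<in> V" "j \<in> V" "i \<noteq> j" using edgeD assms by auto
  have ji: "{j, i} \<in> E" using assms by (simp add: insert_commute)
  have "v i - exponent_gcd (v i) (v j) = Poly_Mapping.single (x j i) 1"
  proof (rule poly_mapping_eqI)
    fix a
    obtain r s where rs: "{r, s} \<in> E" "a = x r s" by (rule indeterminate_cases)
    have r: "r \<in> V" using edgeD rs by blast
    have "of_bool (r \<noteq> i \<and> next_vertex E r i = s) - min (of_bool (r \<noteq> i \<and> next_vertex E r i = s))
        (of_bool (r \<noteq> j \<and> next_vertex E r j = s)) = (of_bool (j = r \<and> i = s) :: nat)"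
    proof (cases "r = i \<or> r = j")
      case True
      then show ?thesis using ij next_vertex_adjacent_target[OF ji] by auto
    next
      case False
      then show ?thesis using next_vertex_adjacent_targets[OF assms r] by auto
    qed
    then show "Poly_Mapping.lookup (v i - exponent_gcd (v i) (v j)) a =
        Poly_Mapping.lookup (Poly_Mapping.single (x j i) 1) a"
      using rs x_eq_iff[OF ji rs(1)] ij
      by (simp add: lookup_minus lookup_exponent_gcd lookup_v lookup_single when_def)
  qed
  then show ?thesis by (simp add: cofactor_gcd_def var_def)
qed

section \<open>Edge relations are indispensable\<close>

text \<open>
  If \<open>v\<^sub>k\<close> divides \<open>v\<^sub>j x\<^sub>j\<^sub>i\<close>, the least common multiple of \<open>v\<^sub>i\<close> and \<open>v\<^sub>j\<close>, then the exponents
  at the indeterminates of \<open>i\<close> and \<open>j\<close> force the vertex \<open>k\<close> to lie behind \<open>j\<close> as seen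
  from \<open>i\<close>, and behind \<open>i\<close> as seen from \<open>j\<close>, unless it is \<open>i\<close> or \<open>j\<close>.
\<close>

lemma generator_divides_edge_lcm:
  assumes e: "{i, j} \<in> E" and k: "k \<in> V" "k \<noteq> j"
    and dvd: "v k - exponent_gcd (v k) (v j) + t = Poly_Mapping.single (x j i) 1"
  shows "k = i"
proof (rule ccontr)
  assume ki: "k \<noteq> i"
  have ij: "i \<in> V" "j \<in> V" "i \<noteq> j" using edgeD e by auto
  have le: "Poly_Mapping.lookup (v k) a \<le>
      Poly_Mapping.lookup (v j) a + Poly_Mapping.lookup (Poly_Mapping.single (x j i) 1) a" for a
    using arg_cong[OF dvd, of "\<lambda>p. Poly_Mapping.lookup p a"]
    by (simp add: lookup_minus lookup_exponent_gcd lookup_add)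
  have ji: "{j, i} \<in> E" using e by (simp add: insert_commute)
  have "next_vertex E i k = j"
  proof -
    have ei: "{i, next_vertex E i k} \<in> E" using next_edge ij k ki by blast
    with le[of "x i (next_vertex E i k)"] x_eq_iff[OF ji ei] ij k ki
    have "next_vertex E i j = next_vertex E i k"
      by (simp add: lookup_v lookup_single when_def of_bool_def split: if_splits)
    with next_vertex_adjacent_target[OF e] show ?thesis by simp
  qed
  moreover have "next_vertex E j k = i"
  proof -
    have ej: "{j, next_vertex E j k} \<in> E" using next_edge ij k by blast
    with le[of "x j (next_vertex E j k)"] x_eq_iff[OF ji ej] ij k
    show ?thesis by (simp add: lookup_v lookup_single when_def split: if_splits)
  qed
  ultimately show False using edge_direction[OF e k(1)] k ki by auto
qed

text \<open>
  The Taylor relation of an edge cannot be combined from other Taylor relations: its term in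
  coordinate \<open>j\<close> must be a multiple of the term of some relation of \<open>j\<close> and \<open>k\<close>, and then
  \<open>v\<^sub>k\<close> divides the least common multiple of \<open>v\<^sub>i\<close> and \<open>v\<^sub>j\<close>.
\<close>

lemma edge_relation_indispensable:
  fixes W :: "('v, 'k::field) mpoly vec set"
  assumes e: "{i, j} \<in> E" "i < j"
    and W: "W \<subseteq> {taylor_relation (m + 1) v k l | k l. 1 \<le> k \<and> k < l \<and> l \<le> m + 1}"
    and span: "taylor_relation (m + 1) v i j \<in> submodule_generated (m + 1) W"
  shows "taylor_relation (m + 1) v i j \<in> W"
proof -
  have ij: "i \<in> V" "j \<in> V" "i \<noteq> j" using edgeD e by auto
  have W': "W \<subseteq> carrier_vec (m + 1)" using W by auto
  have "(taylor_relation (m + 1) v i j :: ('v, 'k) mpoly vec) $ (j - 1) = var (x j i)"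
    using ij by (simp add: taylor_relation_index cofactor_gcd_edge[OF e(1)] del: One_nat_def)
  then have "Poly_Mapping.single (x j i) 1 \<in>
      Poly_Mapping.keys ((taylor_relation (m + 1) v i j :: ('v, 'k) mpoly vec) $ (j - 1))"
    by (simp add: var_def)
  moreover have "j - 1 < m + 1" using ij by auto
  ultimately obtain y s t where y: "y \<in> W" "s \<in> Poly_Mapping.keys (y $ (j - 1))"
      "Poly_Mapping.single (x j i) 1 = t + s"
    using keys_in_submodule_generated[OF W' span] by blast
  obtain k l where kl: "y = taylor_relation (m + 1) v k l" "k \<in> V" "l \<in> V" "k < l"
    using W y(1) by auto
  have "j = k \<or> j = l"
    using y(2) kl ij by (auto simp: taylor_relation_index simp del: One_nat_def split: if_splits)
  then obtain k' where k': "{k', j} = {k, l}" "k' \<in> V" "k' \<noteq> j"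
    using kl by (metis insert_commute nat_neq_iff)
  have "s = v k' - exponent_gcd (v k') (v j)"
    using y(2) kl k' ij
    by (auto simp: taylor_relation_index cofactor_gcd_def doubleton_eq_iff simp del: One_nat_def)
  with y(3) have "v k' - exponent_gcd (v k') (v j) + t = Poly_Mapping.single (x j i) 1"
    by (simp add: add.commute)
  with generator_divides_edge_lcm[OF e(1)] k' have "k' = i" by blast
  with k' kl e have "k = i" "l = j" by (auto simp: doubleton_eq_iff)
  with y kl show ?thesis by simp
qed

section \<open>Edge relations generate all syzygies\<close>

text \<open>
  The order of the ends of an edge determines the sign of its Taylor relation; this vector is
  normalised so that the coordinate at the prescribed end \<open>l\<close> is an indeterminate.
\<close>

lemma edge_relation_from:
  fixes W :: "('v, 'k::field) mpoly vec set"
  assumes e: "{l, p} \<in> E"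
    and W: "W \<subseteq> carrier_vec (m + 1)"
      "\<And>i j. {i, j} \<in> E \<Longrightarrow> i < j \<Longrightarrow> taylor_relation (m + 1) v i j \<in> W"
  obtains y where "y \<in> submodule_generated (m + 1) W" "y \<in> syzygies (m + 1) v"
    "y $ (l - 1) = var (x l p)" "\<And>k. k \<in> V \<Longrightarrow> k \<noteq> l \<Longrightarrow> k \<noteq> p \<Longrightarrow> y $ (k - 1) = 0"
proof -
  have lp: "l \<in> V" "p \<in> V" "l \<noteq> p" using edgeD e by auto
  have pl: "{p, l} \<in> E" using e by (simp add: insert_commute)
  show ?thesis
  proof (cases "p < l")
    case True
    let ?y = "taylor_relation (m + 1) v p l :: ('v, 'k) mpoly vec"
    show ?thesis
    proof (rule that[of ?y])
      show "?y \<in> submodule_generated (m + 1) W"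
        using W(2)[OF pl True] submodule_generated_closed(1)[OF W(1)] by blast
      show "?y \<in> syzygies (m + 1) v" using taylor_relation_syzygy lp by metis
    qed (use lp in \<open>auto simp: taylor_relation_index cofactor_gcd_edge[OF pl] simp del: One_nat_def\<close>)
  next
    case False
    then have lt: "l < p" using lp by simp
    let ?y = "taylor_relation (m + 1) v l p :: ('v, 'k) mpoly vec"
    have idx: "k - 1 < dim_vec ?y" if "k \<in> V" for k
      using that by auto
    show ?thesis
    proof (rule that[of "(- 1) \<cdot>\<^sub>v ?y"])
      show "(- 1) \<cdot>\<^sub>v ?y \<in> submodule_generated (m + 1) W"
        using W(2)[OF e lt] submodule_generated_closed(1,4)[OF W(1)] by blast
      show "(- 1) \<cdot>\<^sub>v ?y \<in> syzygies (m + 1) v" using taylor_relation_syzygy syzygies_closed lp by metis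
      show "((- 1) \<cdot>\<^sub>v ?y) $ (l - 1) = var (x l p)"
        unfolding index_smult_vec(1)[OF idx[OF lp(1)]]
        using lp by (simp add: taylor_relation_index cofactor_gcd_edge[OF pl] del: One_nat_def)
      show "((- 1) \<cdot>\<^sub>v ?y) $ (k - 1) = 0" if "k \<in> V" "k \<noteq> l" "k \<noteq> p" for k
        unfolding index_smult_vec(1)[OF idx[OF that(1)]]
        using lp that by (simp add: taylor_relation_index del: One_nat_def)
    qed
  qed
qed

text \<open>
  The set \<open>T\<close> contains the support of the syzygy \<open>w\<close>, and no vertex of \<open>T\<close> is
  farther from the root \<open>1\<close> than \<open>l\<close>. Then all \<open>v\<^sub>k\<close> with \<open>k \<in> T\<close> and \<open>k \<noteq> l\<close> contain
  the indeterminate of the edge from \<open>l\<close> towards the root, while \<open>v\<^sub>l\<close> does not.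
\<close>

lemma farthest_coordinate_divisible:
  fixes w :: "('v, 'k::field) mpoly vec"
  assumes w: "w \<in> syzygies (m + 1) v" "\<And>k. k \<in> V - T \<Longrightarrow> w $ (k - 1) = 0"
    and l: "l \<in> V" "l \<noteq> 1" "\<And>k. k \<in> T - {1} \<Longrightarrow> path_length k 1 \<le> path_length l 1"
  shows "\<exists>q. w $ (l - 1) = q * var (x l (next_vertex E l 1))"
  unfolding var_def
proof (rule divisible_by_monomial, rule single_divides_exponent)
  let ?p = "next_vertex E l 1"
  fix t assume t: "t \<in> Poly_Mapping.keys (w $ (l - 1))"
  have one: "1 \<in> V" by simp
  have e: "{l, ?p} \<in> E" using next_edge l one by blast
  \<comment> \<open>The term \<open>t\<close> of coordinate \<open>l\<close> contributes to the coefficient of \<open>t v\<^sub>l\<close> in the sum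
    \<open>\<Sum>k. w\<^sub>k v\<^sub>k = 0\<close>, so some other summand must contribute as well.\<close>
  let ?c = "\<lambda>k. Poly_Mapping.lookup (w $ (k - 1) * monomial (v k)) (t + v l)"
  have "(\<Sum>k\<in>V. ?c k) = 0" using w(1) by (simp add: syzygies_def flip: lookup_sum)
  moreover have "?c l \<noteq> 0" using t by (simp add: lookup_mult_monomial in_keys_iff)
  moreover have "(\<Sum>k\<in>V. ?c k) = ?c l + (\<Sum>k\<in>V - {l}. ?c k)" using l(1) by (intro sum.remove) simp
  ultimately have "(\<Sum>k\<in>V - {l}. ?c k) \<noteq> 0" by auto
  then obtain k where "k \<in> V - {l}" "?c k \<noteq> 0" by (rule sum.not_neutral_contains_not_neutral)
  then obtain k where k: "k \<in> V" "k \<noteq> l" "?c k \<noteq> 0" by blast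
  then have "w $ (k - 1) \<noteq> 0" by auto
  then have "k \<in> T" using w(2) k by blast
  have "next_vertex E l k = ?p"
  proof (cases "k = 1")
    case False
    with \<open>k \<in> T\<close> l(3) have "\<not> path_length l 1 < path_length k 1" by fastforce
    with path_length_away[OF one l(1,2) k(1,2)] show ?thesis by blast
  qed simp
  with e k l have vk: "Poly_Mapping.lookup (v k) (x l ?p) = 1" by (simp add: lookup_v del: One_nat_def)
  have vl: "Poly_Mapping.lookup (v l) (x l ?p) = 0" using e l by (simp add: lookup_v del: One_nat_def)
  have "t + v l \<in> Poly_Mapping.keys (w $ (k - 1) * monomial (v k))" using k(3) by (simp add: in_keys_iff)
  then obtain a where "t + v l = a + v k" by (auto elim: keys_multE)
  then have "Poly_Mapping.lookup (t + v l) (x l ?p) = Poly_Mapping.lookup (a + v k) (x l ?p)" by simp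
  with vk vl show "Poly_Mapping.lookup t (x l ?p) \<ge> 1" by (simp add: lookup_add)
qed

text \<open>
  Subtracting a multiple of the relation between the farthest vertex \<open>l\<close> of \<open>T\<close> and the next vertex
  towards the root \<open>1\<close> removes \<open>l\<close> from the support. The set \<open>T\<close> has to be closed under moving
  towards the root, since the subtraction changes the coordinate of that next vertex. In the end only the
  root is left, and a syzygy supported at one vertex vanishes.
\<close>

lemma syzygy_in_span_of_edge_relations:
  fixes W :: "('v, 'k::field) mpoly vec set"
  assumes W: "W \<subseteq> carrier_vec (m + 1)"
      "\<And>i j. {i, j} \<in> E \<Longrightarrow> i < j \<Longrightarrow> taylor_relation (m + 1) v i j \<in> W"
    and "T \<subseteq> V" "\<And>l. l \<in> T \<Longrightarrow> l \<noteq> 1 \<Longrightarrow> next_vertex E l 1 \<in> T"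
    and "w \<in> syzygies (m + 1) v" "\<And>k. k \<in> V - T \<Longrightarrow> w $ (k - 1) = 0"
  shows "w \<in> submodule_generated (m + 1) W"
  using assms(3-)
proof (induction "card T" arbitrary: T w rule: less_induct)
  case less
  have finT: "finite T" using less.prems(1) finite_subset by blast
  have w: "w \<in> carrier_vec (m + 1)" using less.prems(3) by (simp add: syzygies_def)
  show ?case
  proof (cases "T \<subseteq> {1}")
    case True
    have zero: "w $ (k - 1) = 0" if "k \<in> V - {1}" for k using that True less.prems(4) by blast
    have "0 = (\<Sum>k\<in>V. w $ (k - 1) * monomial (v k))" using less.prems(3) by (simp add: syzygies_def)
    also have "\<dots> = w $ (1 - 1) * monomial (v 1) + (\<Sum>k\<in>V - {1}. w $ (k - 1) * monomial (v k))"
      by (rule sum.remove) auto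
    also have "(\<Sum>k\<in>V - {1}. w $ (k - 1) * monomial (v k)) = 0"
      by (rule sum.neutral) (use zero in auto)
    finally have "w $ (1 - 1) = 0" by (simp add: mult_monomial_eq_0_iff)
    with zero have zero: "w $ (k - 1) = 0" if "k \<in> V" for k using that by (cases "k = 1") auto
    have "w = 0\<^sub>v (m + 1)"
    proof (rule eq_vecI)
      fix c assume "c < dim_vec (0\<^sub>v (m + 1))"
      with zero[of "c + 1"] show "w $ c = 0\<^sub>v (m + 1) $ c" by simp
    qed (use w in simp)
    then show ?thesis using submodule_generated_closed(2)[OF W(1)] by simp
  next
    case False
    have "Max ((\<lambda>k. path_length k 1) ` (T - {1})) \<in> (\<lambda>k. path_length k 1) ` (T - {1})"
      using False finT by (intro Max_in) auto
    then obtain l where l: "l \<in> T" "l \<noteq> 1"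
        "path_length l 1 = Max ((\<lambda>k. path_length k 1) ` (T - {1}))"
      by (metis (no_types, lifting) DiffD1 DiffD2 imageE singletonI)
    have l_max: "path_length k 1 \<le> path_length l 1" if "k \<in> T - {1}" for k
      unfolding l(3) using that finT by (intro Max_ge) auto
    let ?p = "next_vertex E l 1"
    have lV: "l \<in> V" using l less.prems by blast
    have one: "1 \<in> V" by simp
    have pT: "?p \<in> T" using less.prems l by blast
    have e: "{l, ?p} \<in> E" using next_edge[OF lV one l(2)] .
    obtain q where q: "w $ (l - 1) = q * var (x l ?p)"
      using farthest_coordinate_divisible[OF less.prems(3,4) lV l(2) l_max] by blast
    obtain y where y: "y \<in> submodule_generated (m + 1) W" "y \<in> syzygies (m + 1) v"
        "y $ (l - 1) = var (x l ?p)" "\<And>k. k \<in> V \<Longrightarrow> k \<noteq> l \<Longrightarrow> k \<noteq> ?p \<Longrightarrow> y $ (k - 1) = 0"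
      using edge_relation_from[OF e W] by blast
    have yc: "y \<in> carrier_vec (m + 1)" using y(2) by (simp add: syzygies_def)
    define w' where "w' = w + (- q) \<cdot>\<^sub>v y"
    have w'_index: "w' $ (k - 1) = w $ (k - 1) - q * y $ (k - 1)" if "k \<in> V" for k
    proof -
      have "k - 1 < m + 1" using that by auto
      with w yc show ?thesis by (simp add: w'_def)
    qed
    have "w' \<in> submodule_generated (m + 1) W"
    proof (rule less.hyps[of "T - {l}"])
      show "card (T - {l}) < card T" using finT l by (intro card_Diff1_less)
      show "T - {l} \<subseteq> V" using less.prems by blast
      show "next_vertex E k 1 \<in> T - {l}" if k: "k \<in> T - {l}" "k \<noteq> 1" for k
      proof -
        have "k \<in> V" using k less.prems by blast
        from path_length_next[OF this one k(2)] l_max[of k] k have "next_vertex E k 1 \<noteq> l" by auto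
        with less.prems k show ?thesis by blast
      qed
      show "w' \<in> syzygies (m + 1) v"
        unfolding w'_def using less.prems(3) y(2) by (intro syzygies_closed)
      show "w' $ (k - 1) = 0" if k: "k \<in> V - (T - {l})" for k
      proof (cases "k = l")
        case True
        then show ?thesis using w'_index[OF lV] q y(3) by simp
      next
        case False
        with k pT have "k \<in> V - T" "k \<noteq> ?p" by auto
        with w'_index[of k] y(4)[of k] less.prems(4) False show ?thesis by simp
      qed
    qed
    with y(1) have "w' + q \<cdot>\<^sub>v y \<in> submodule_generated (m + 1) W"
      by (intro submodule_generated_closed[OF W(1)])
    moreover have "w' + q \<cdot>\<^sub>v y = w"
      by (rule eq_vecI) (use w yc in \<open>auto simp: w'_def\<close>)
    ultimately show ?thesis by simp
  qed
qed

lemma edge_relations_generate_syzygies: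
  fixes W :: "('v, 'k::field) mpoly vec set"
  assumes "W \<subseteq> {taylor_relation (m + 1) v k l | k l. 1 \<le> k \<and> k < l \<and> l \<le> m + 1}"
    and "\<And>i j. {i, j} \<in> E \<Longrightarrow> i < j \<Longrightarrow> taylor_relation (m + 1) v i j \<in> W"
  shows "submodule_generated (m + 1) W = syzygies (m + 1) v"
proof
  have "W \<subseteq> syzygies (m + 1) v"
  proof
    fix w assume "w \<in> W"
    then obtain k l where kl: "w = taylor_relation (m + 1) v k l" "1 \<le> k" "k < l" "l \<le> m + 1"
      using assms(1) by blast
    then have "k \<in> V" "l \<in> V" "k \<noteq> l" by auto
    then show "w \<in> syzygies (m + 1) v" unfolding kl(1) by (rule taylor_relation_syzygy)
  qed
  then show "submodule_generated (m + 1) W \<subseteq> syzygies (m + 1) v"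
    by (rule submodule_generated_minimal) (auto simp: syzygies_closed, simp add: syzygies_def)
  have "W \<subseteq> carrier_vec (m + 1)" using assms(1) by auto
  moreover have "next_vertex E l 1 \<in> V" if "l \<in> V" "l \<noteq> 1" for l
    using edgeD[OF next_edge[OF that(1) _ that(2)]] by simp
  ultimately show "syzygies (m + 1) v \<subseteq> submodule_generated (m + 1) W"
    using syzygy_in_span_of_edge_relations[OF _ assms(2), of V] by blast
qed

section \<open>The generic ideal and its generators\<close>

text \<open>
  No generator divides another one: for \<open>l \<noteq> k\<close>, the monomial \<open>v\<^sub>l\<close> contains an
  indeterminate of the vertex \<open>k\<close>, while \<open>v\<^sub>k\<close> contains none.
\<close>

lemma generators_minimal:
  assumes "k \<in> V"
  shows "ideal_generated ((\<lambda>i. monomial (v i)) ` (V - {k})) \<noteq>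
    (ideal_generated ((\<lambda>i. monomial (v i)) ` V) :: ('v, 'k::field) mpoly set)"
proof
  assume eq: "ideal_generated ((\<lambda>i. monomial (v i)) ` (V - {k})) =
    (ideal_generated ((\<lambda>i. monomial (v i)) ` V) :: ('v, 'k) mpoly set)"
  have "(monomial (v k) :: ('v, 'k) mpoly) \<in> ideal_generated (monomial ` v ` (V - {k}))"
    using ideal_generated_superset[of "(\<lambda>i. monomial (v i)) ` V"] assms
    unfolding image_image eq by blast
  then have "\<exists>s\<in>v ` (V - {k}). \<exists>t. v k = t + s" by (rule keys_in_monomial_ideal) simp
  then obtain l t where l: "l \<in> V" "l \<noteq> k" "v k = t + v l" by blast
  let ?s = "next_vertex E k l"
  have e: "{k, ?s} \<in> E" using next_edge assms l by blast
  have "Poly_Mapping.lookup (v k) (x k ?s) = Poly_Mapping.lookup (t + v l) (x k ?s)" using l by simp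
  with e assms l(1,2) show False by (simp add: lookup_v lookup_add)
qed

lemma generic_matrix_entry:
  assumes "k < m" "es ! k \<in> E" "l \<in> V"
  shows "l \<notin> es ! k \<Longrightarrow> generic_matrix m es x $$ (k, l - 1) = (0 :: ('v, 'k::field) mpoly)"
    and "es ! k = {l, s} \<Longrightarrow> generic_matrix m es x $$ (k, l - 1) = (var (x l s) :: ('v, 'k) mpoly) \<or>
      generic_matrix m es x $$ (k, l - 1) = (- var (x l s) :: ('v, 'k) mpoly)"
proof -
  obtain r r' where r: "es ! k = {r, r'}" "r < r'"
    using assms(2) by (rule ordered_edgeE)
  have l: "l - 1 < m + 1" "l - 1 + 1 = l" using assms(3) by auto
  have entry: "generic_matrix m es x $$ (k, l - 1) =
      (if l = r then - var (x r r') else if l = r' then var (x r' r) else (0 :: ('v, 'k) mpoly))"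
    using assms(1) l r by (simp add: generic_matrix_def Let_def)
  show "l \<notin> es ! k \<Longrightarrow> generic_matrix m es x $$ (k, l - 1) = (0 :: ('v, 'k) mpoly)"
    using entry r by auto
  show "generic_matrix m es x $$ (k, l - 1) = (var (x l s) :: ('v, 'k) mpoly) \<or>
      generic_matrix m es x $$ (k, l - 1) = (- var (x l s) :: ('v, 'k) mpoly)" if "es ! k = {l, s}"
    using entry that r by (auto simp: doubleton_eq_iff)
qed

lemma row_generic_matrix:
  assumes "k < m" "es ! k = {i, j}" "{i, j} \<in> E" "i < j"
  shows "row (generic_matrix m es x) k = (taylor_relation (m + 1) v i j :: ('v, 'k::field) mpoly vec)"
proof (rule eq_vecI)
  have ij: "i \<in> V" "j \<in> V" "i \<noteq> j" "{j, i} \<in> E" using edgeD assms by (auto simp: insert_commute)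
  show "dim_vec (row (generic_matrix m es x) k) =
      dim_vec (taylor_relation (m + 1) v i j :: ('v, 'k) mpoly vec)"
    by (simp add: generic_matrix_def)
  fix c assume "c < dim_vec (taylor_relation (m + 1) v i j :: ('v, 'k) mpoly vec)"
  then have c: "c + 1 \<in> V" by simp
  have "(taylor_relation (m + 1) v i j :: ('v, 'k) mpoly vec) $ c =
      (if c + 1 = j then var (x j i) else if c + 1 = i then - var (x i j) else 0)"
    using taylor_relation_index[OF ij(1-3) c, of v]
    unfolding cofactor_gcd_edge[OF assms(3)] cofactor_gcd_edge[OF ij(4)] by simp
  then show "row (generic_matrix m es x) k $ c = (taylor_relation (m + 1) v i j :: ('v, 'k) mpoly vec) $ c"
    using c assms ij by (auto simp: generic_matrix_def Let_def)
qed

text \<open>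
  In the Leibniz expansion of the minor that omits column \<open>i\<close>, a nonzero term assigns to every
  vertex other than \<open>i\<close> an edge at this vertex, bijectively; there is only one such assignment,
  the first edge of the path to \<open>i\<close>.
\<close>

lemma maximal_minor_eq:
  assumes es: "distinct es" "set es = E" and i: "i \<in> V"
  shows "maximal_minor (generic_matrix m es x) i = (monomial (v i) :: ('v, 'k::field) mpoly) \<or>
    maximal_minor (generic_matrix m es x) i = (- monomial (v i) :: ('v, 'k) mpoly)"
proof -
  define A :: "('v, 'k) mpoly mat" where "A = generic_matrix m es x"
  define B where "B = submatrix A UNIV (- {i - 1})"
  define q where "q = (\<lambda>c. Suc (pick (- {i - 1}) c))"
  define first where "first = (\<lambda>r. {r, next_vertex E r i})"
  have len: "length es = m" using distinct_card[OF es(1)] es(2) card_edges by simp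
  have q: "bij_betw q {0..<m} (V - {i})" unfolding q_def by (rule bij_betw_pick_omit[OF i])
  then have qV: "q c \<in> V" "q c \<noteq> i" if "c < m" for c
    using that bij_betwE[OF q] by auto
  have first: "bij_betw first (V - {i}) E" unfolding first_def by (rule bij_betw_first_edge[OF i])
  have nth: "bij_betw ((!) es) {0..<m} E" using bij_betw_nth[OF es(1), of "{0..<m}" E] len es(2)
    by (simp add: lessThan_atLeast0)
  have first_q: "bij_betw (first \<circ> q) {0..<m} E" by (rule bij_betw_trans[OF q first])
  have esE: "es ! k \<in> E" if "k < m" for k using that len es(2) nth_mem by blast
  have dim: "dim_row A = m" "dim_col A = m + 1" by (simp_all add: A_def generic_matrix_def)
  have card: "card {a. a < dim_col A \<and> a \<in> - {i - 1}} = m"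
    unfolding dim by (rule card_omit[OF i])
  have card': "card {a. a < dim_row A \<and> a \<in> UNIV} = m"
    by (simp add: dim)
  have B: "B \<in> carrier_mat m m"
    unfolding B_def by (rule carrier_matI) (simp_all only: dim_submatrix card card')
  have B_index: "B $$ (k, c) = A $$ (k, q c - 1)" if "k < m" "c < m" for k c
    unfolding B_def q_def using that
    by (subst submatrix_index) (simp_all only: card card' pick_UNIV diff_Suc_1)
  define good where "good p \<longleftrightarrow> p permutes {0..<m} \<and> (\<forall>k<m. es ! k = first (q (p k)))" for p
  \<comment> \<open>\<open>q c\<close> is the vertex of column \<open>c\<close> of the minor, so the term of \<open>p\<close> pairs the edge
    \<open>es ! k\<close> with the vertex \<open>q (p k)\<close>. The good permutations are those with a nonzero term.\<close>
  have good: "good p" if p: "p permutes {0..<m}" "(\<Prod>k = 0..<m. B $$ (k, p k)) \<noteq> 0" for p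
  proof -
    have pm: "p k < m" if "k < m" for k using permutes_in_image[OF p(1), of k] that by simp
    have inc: "q (p k) \<in> es ! k" if "k < m" for k
    proof (rule ccontr)
      assume "q (p k) \<notin> es ! k"
      then have "B $$ (k, p k) = 0"
        using generic_matrix_entry(1)[OF that esE[OF that] qV(1)[OF pm[OF that]], where ?'k = 'k]
        by (simp add: B_index that pm A_def)
      with that have "(\<Prod>k = 0..<m. B $$ (k, p k)) = 0" by (intro prod_zero) auto
      with p(2) show False by simp
    qed
    have qp: "bij_betw (q \<circ> p) {0..<m} (V - {i})"
      by (rule bij_betw_trans[OF permutes_imp_bij[OF p(1)] q])
    let ?k = "inv_into {0..<m} (q \<circ> p)"
    have k: "?k r < m" "q (p (?k r)) = r" if "r \<in> V - {i}" for r
      using that bij_betw_inv_into_right[OF qp, of r] bij_betwE[OF bij_betw_inv_into[OF qp]] by auto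
    have inj: "inj_on (\<lambda>r. es ! ?k r) (V - {i})"
      using bij_betw_trans[OF bij_betw_inv_into[OF qp] nth] by (simp add: bij_betw_def o_def)
    have inc': "es ! ?k r \<in> E \<and> r \<in> es ! ?k r" if "r \<in> V - {i}" for r
      using k[OF that] inc[of "?k r"] esE by simp
    have choice: "es ! ?k r = first r" if "r \<in> V - {i}" for r
      unfolding first_def by (rule incident_edge_choice_unique[OF i inj inc' that])
    have "es ! k = first (q (p k))" if "k < m" for k
      using choice[of "q (p k)"] qV[OF pm[OF that]] bij_betw_inv_into_left[OF qp, of k] that by simp
    with p show ?thesis by (simp add: good_def)
  qed
  obtain p0 where p0: "good p0"
  proof
    define p0 where "p0 k = (if k \<in> {0..<m} then inv_into {0..<m} (first \<circ> q) (es ! k) else k)" for k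
    have "bij_betw (inv_into {0..<m} (first \<circ> q) \<circ> (!) es) {0..<m} {0..<m}"
      by (rule bij_betw_trans[OF nth bij_betw_inv_into[OF first_q]])
    then have "bij_betw p0 {0..<m} {0..<m}"
      by (rule bij_betw_cong[THEN iffD1, rotated]) (simp add: p0_def)
    then have "p0 permutes {0..<m}" by (rule bij_imp_permutes) (simp add: p0_def)
    moreover have "es ! k = first (q (p0 k))" if "k < m" for k
      using bij_betw_inv_into_right[OF first_q esE[OF that]] that by (simp add: p0_def)
    ultimately show "good p0" by (simp add: good_def)
  qed
  have unique: "p = p0" if "good p" for p
  proof
    fix k
    show "p k = p0 k"
    proof (cases "k < m")
      case True
      then have "(first \<circ> q) (p k) = (first \<circ> q) (p0 k)" using that p0 by (simp add: good_def)
      moreover have "p k \<in> {0..<m}" "p0 k \<in> {0..<m}"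
        using that p0 True permutes_in_image[of _ "{0..<m}" k] by (auto simp: good_def)
      ultimately show ?thesis by (rule inj_onD[OF bij_betw_imp_inj_on[OF first_q]])
    next
      case False
      moreover have "p permutes {0..<m}" "p0 permutes {0..<m}" using that p0 unfolding good_def by blast+
      ultimately show ?thesis by (simp add: permutes_not_in)
    qed
  qed
  have p0_perm: "p0 permutes {0..<m}" using p0 by (simp add: good_def)
  have "det B = (\<Sum>p\<in>{p. p permutes {0..<m}}. signof p * (\<Prod>k = 0..<m. B $$ (k, p k)))"
    by (rule det_def'[OF B])
  also have "\<dots> = (\<Sum>p\<in>{p0}. signof p * (\<Prod>k = 0..<m. B $$ (k, p k)))"
  proof (rule sum.mono_neutral_right)
    show "\<forall>p\<in>{p. p permutes {0..<m}} - {p0}. signof p * (\<Prod>k = 0..<m. B $$ (k, p k)) = 0"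
    proof
      fix p assume "p \<in> {p. p permutes {0..<m}} - {p0}"
      then have "p permutes {0..<m}" "\<not> good p" using unique by blast+
      then have "(\<Prod>k = 0..<m. B $$ (k, p k)) = 0" using good by blast
      then show "signof p * (\<Prod>k = 0..<m. B $$ (k, p k)) = 0" by simp
    qed
  qed (simp_all add: p0_perm finite_permutations)
  finally have det: "det B = signof p0 * (\<Prod>k = 0..<m. B $$ (k, p0 k))" by simp
  have "(\<Prod>k = 0..<m. B $$ (k, p0 k)) =
        (\<Prod>k = 0..<m. var (x (q (p0 k)) (next_vertex E (q (p0 k)) i))) \<or>
      (\<Prod>k = 0..<m. B $$ (k, p0 k)) =
        - (\<Prod>k = 0..<m. var (x (q (p0 k)) (next_vertex E (q (p0 k)) i)))"
  proof (rule prod_cong_sign)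
    fix k assume "k \<in> {0..<m}"
    then have k: "k < m" "p0 k < m" using permutes_in_image[OF p0_perm, of k] by auto
    have "es ! k = {q (p0 k), next_vertex E (q (p0 k)) i}"
      using p0 k by (simp add: good_def first_def)
    from generic_matrix_entry(2)[where ?'k = 'k, OF k(1) esE[OF k(1)] qV(1)[OF k(2)] this]
    show "B $$ (k, p0 k) = var (x (q (p0 k)) (next_vertex E (q (p0 k)) i)) \<or>
        B $$ (k, p0 k) = - var (x (q (p0 k)) (next_vertex E (q (p0 k)) i))"
      by (simp add: B_index k A_def)
  qed
  moreover have "(\<Prod>k = 0..<m. var (x (q (p0 k)) (next_vertex E (q (p0 k)) i))) =
      (monomial (v i) :: ('v, 'k) mpoly)"
  proof -
    have "bij_betw (q \<circ> p0) {0..<m} (V - {i})"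
      by (rule bij_betw_trans[OF permutes_imp_bij[OF p0_perm] q])
    from prod.reindex_bij_betw[OF this, of "\<lambda>r. var (x r (next_vertex E r i)) :: ('v, 'k) mpoly"]
    show ?thesis by (simp add: prod_var generic_generator_def)
  qed
  moreover have "signof p0 = (1 :: ('v, 'k) mpoly) \<or> signof p0 = (- 1 :: ('v, 'k) mpoly)"
    by (simp add: sign_def)
  ultimately have "det B = monomial (v i) \<or> det B = - monomial (v i)"
    unfolding det by auto
  then show ?thesis by (simp add: maximal_minor_def B_def A_def)
qed

lemma generators_of_generic_ideal:
  assumes "distinct es" "set es = E"
  shows "minimal_monomial_generators (m + 1) (generic_ideal m es x :: ('v, 'k::field) mpoly set) v"
proof -
  have "ideal_generated ((\<lambda>i. monomial (v i)) ` V) = (generic_ideal m es x :: ('v, 'k) mpoly set)"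
    unfolding generic_ideal_def
  proof (rule ideal_generated_cong_sign)
    fix i assume "i \<in> V"
    from maximal_minor_eq[OF assms this, where ?'k = 'k]
    show "monomial (v i) = maximal_minor (generic_matrix m es x :: ('v, 'k) mpoly mat) i \<or>
        monomial (v i) = - maximal_minor (generic_matrix m es x :: ('v, 'k) mpoly mat) i"
      by auto
  qed
  with generators_minimal[where ?'k = 'k] show ?thesis unfolding minimal_monomial_generators_def by blast
qed

section \<open>Relation trees of the generic ideal\<close>

lemma edges_subset_relation_graph:
  fixes H :: "('v, 'k::field) mpoly mat"
  assumes "hilbert_burch_matrix m I v H"
  shows "E \<subseteq> relation_graph m v H"
proof
  fix e assume e: "e \<in> E"
  then obtain i j where ij: "e = {i, j}" "i \<in> V" "j \<in> V" "i < j"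
    by (rule ordered_edgeE)
  let ?W = "row H ` {..<m}"
  have rows: "?W \<subseteq> {taylor_relation (m + 1) v k l | k l. 1 \<le> k \<and> k < l \<and> l \<le> m + 1}"
    using assms by (fastforce simp: hilbert_burch_matrix_def)
  have span: "taylor_relation (m + 1) v i j \<in> submodule_generated (m + 1) ?W"
    using assms ij taylor_relation_syzygy[of i "m + 1" j v] unfolding hilbert_burch_matrix_def by auto
  have "{i, j} \<in> E" using e ij(1) by simp
  then have "taylor_relation (m + 1) v i j \<in> ?W"
    by (rule edge_relation_indispensable[OF _ ij(4) rows span])
  then obtain k where "k < m" "row H k = taylor_relation (m + 1) v i j" by auto
  with ij show "e \<in> relation_graph m v H" unfolding relation_graph_def by auto
qed

text \<open>
  The tree and the relation graph agree by counting: the tree has \<open>m\<close> edges, and the \<open>m\<close>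
  rows of \<open>H\<close> yield at most \<open>m\<close> edges.
\<close>

lemma relation_graph_eq_edges:
  fixes H :: "('v, 'k::field) mpoly mat"
  assumes "hilbert_burch_matrix m I v H"
  shows "relation_graph m v H = E"
  using card_seteq[OF _ edges_subset_relation_graph[OF assms]] card_relation_graph_le[of m v H]
    card_edges by simp

text \<open>
  Omitting a row of the generic matrix destroys generation, because the relation of this edge is
  indispensable and no other row equals it.
\<close>

lemma hilbert_burch_generic_matrix:
  assumes es: "distinct es" "set es = E"
  shows "hilbert_burch_matrix m (generic_ideal m es x) v (generic_matrix m es x :: ('v, 'k::field) mpoly mat)"
proof -
  let ?H = "generic_matrix m es x :: ('v, 'k) mpoly mat"
  have len: "length es = m" using distinct_card[OF es(1)] es(2) card_edges by simp
  have rows: "\<exists>i j. es ! k = {i, j} \<and> {i, j} \<in> E \<and> 1 \<le> i \<and> i < j \<and> j \<le> m + 1 \<and>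
      row ?H k = taylor_relation (m + 1) v i j" if "k < m" for k
  proof -
    have "es ! k \<in> E" using that len es(2) nth_mem by blast
    then obtain i j where ij: "es ! k = {i, j}" "i \<in> V" "j \<in> V" "i < j"
      by (rule ordered_edgeE)
    have e: "{i, j} \<in> E" using \<open>es ! k \<in> E\<close> ij(1) by simp
    with ij show ?thesis
      by (intro exI[of _ i] exI[of _ j] conjI row_generic_matrix[OF that]) auto
  qed
  have Taylor: "row ?H ` K \<subseteq> {taylor_relation (m + 1) v k l | k l. 1 \<le> k \<and> k < l \<and> l \<le> m + 1}"
    if "K \<subseteq> {..<m}" for K
    using rows that by blast
  have edge: "taylor_relation (m + 1) v i j \<in> row ?H ` {..<m}" if "{i, j} \<in> E" "i < j" for i j
  proof -
    have "{i, j} \<in> set es" using that es(2) by simp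
    then obtain k where "k < m" "es ! k = {i, j}" unfolding in_set_conv_nth len by blast
    then have "row ?H k = taylor_relation (m + 1) v i j" using that by (intro row_generic_matrix)
    with \<open>k < m\<close> show ?thesis by (intro image_eqI[of _ _ k]) simp_all
  qed
  have gen: "submodule_generated (m + 1) (row ?H ` {..<m}) = syzygies (m + 1) v"
    by (rule edge_relations_generate_syzygies) (use Taylor[of "{..<m}"] edge in blast)+
  have "submodule_generated (m + 1) (row ?H ` ({..<m} - {k})) \<noteq> syzygies (m + 1) v" if k: "k < m" for k
  proof
    assume *: "submodule_generated (m + 1) (row ?H ` ({..<m} - {k})) = syzygies (m + 1) v"
    obtain i j where ij: "es ! k = {i, j}" "{i, j} \<in> E" "1 \<le> i" "i < j" "j \<le> m + 1"
      using rows[OF k] by blast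
    have span: "taylor_relation (m + 1) v i j \<in> submodule_generated (m + 1) (row ?H ` ({..<m} - {k}))"
      unfolding * using ij by (intro taylor_relation_syzygy) auto
    have "taylor_relation (m + 1) v i j \<in> row ?H ` ({..<m} - {k})"
      by (rule edge_relation_indispensable[OF ij(2,4) Taylor[OF Diff_subset] span])
    then obtain k' where "k' \<in> {..<m} - {k}" "taylor_relation (m + 1) v i j = row ?H k'" by (rule imageE)
    then have k': "k' < m" "k' \<noteq> k" "row ?H k' = taylor_relation (m + 1) v i j" by simp_all
    obtain i' j' where ij': "es ! k' = {i', j'}" "1 \<le> i'" "i' < j'" "j' \<le> m + 1"
      "row ?H k' = taylor_relation (m + 1) v i' j'"
      using rows[OF k'(1)] by blast
    let ?supp = "\<lambda>y :: ('v, 'k) mpoly vec. {c \<in> V. y $ (c - 1) \<noteq> 0}"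
    have "{i, j} = ?supp (taylor_relation (m + 1) v i j)"
      by (rule taylor_relation_support[symmetric]) (use ij in auto)
    also have "\<dots> = ?supp (taylor_relation (m + 1) v i' j')" by (simp only: flip: k'(3) ij'(5))
    also have "\<dots> = {i', j'}" by (rule taylor_relation_support) (use ij' in auto)
    finally have "{i, j} = {i', j'}" .
    with ij ij' have "es ! k = es ! k'" by simp
    with k k' es(1) len show False by (simp add: nth_eq_iff_index_eq)
  qed
  moreover have "\<forall>k<m. \<exists>i j. 1 \<le> i \<and> i < j \<and> j \<le> m + 1 \<and> row ?H k = taylor_relation (m + 1) v i j"
    using rows by blast
  moreover have "?H \<in> carrier_mat m (m + 1)" by (simp add: generic_matrix_def)
  ultimately show ?thesis
    using generators_of_generic_ideal[OF es] gen unfolding hilbert_burch_matrix_def by blast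
qed

end

theorem proposition2p1:
  fixes m :: nat
    and E :: "nat set set"
    and es :: "nat set list"
    and x :: "nat \<Rightarrow> nat \<Rightarrow> 'v"
  assumes "m \<ge> 1"
    and "tree_graph {1..m + 1} E"
    and "distinct es" and "set es = E"
    and "bij_betw (\<lambda>(i, j). x i j) {(i, j). {i, j} \<in> E} (UNIV :: 'v set)"
  shows "relation_trees m (generic_ideal m es x :: ('v, 'k::field) mpoly set)
           (generic_generator m E x) = {E}"
proof -
  interpret generic_tree m E x
    by unfold_locales (use assms in auto)
  show ?thesis
    unfolding relation_trees_def
    using hilbert_burch_generic_matrix[OF assms(3,4)] relation_graph_eq_edges by blast
qed

end
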